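(* Let $p$ be a prime, $K$ a finite field of characteristic $p$ with $|K|=q$, $T\colon K\to\mathbf F_p$ the trace map, $W$ a nonzero $K$-vector space of finite $\mathbf F_p$-dimension $n$, $V=W^*\oplus W$, and $f\colon V\times V\to\mathbf F_p$ the $\mathbf F_p$-bilinear form $$f((\alpha,x),(\beta,y))=T(x\beta)\qquad(x,y\in W,\ \alpha,\beta\in W^* ).$$ Let $\rho\colon E(f)\to\mathrm{GL}(V')$ be an absolutely irreducible representation of degree $p^n$ over a field $K'$, and let $\sigma$ be the associated factor set on $G(f)$. For $g\in G(f)$ put $j(g)=\dim_K(I(g)\cap W)$ and $\mu(g)=q^{-j(g)}\in K'$. Then $\mu$ splits $\sigma$, i.e. $$\sigma(g,h)=\mu(g)\mu(h)\mu(gh)^{-1}\qquad\text{for all }g,h\in G(f),$$ and $\mu(g)=\mu(g^{-1})^{\eta'}$ for all $g\in G(f)$ and every automorphism $\eta'$ of $K'$ inverting $\epsilon$.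
   Context: Linear maps act on the right, and $x\beta$ denotes the value of $\beta\in W^*$ at $x\in W$. $W$ is identified with the subspace $0\oplus W$ of $V$. $f^{\mathrm t}(x,y)=f(y,x)$; here $f-f^{\mathrm t}$ is nondegenerate. $E(f)$ is the extraspecial group $V\times\mathbf F_p$ with multiplication $(x_1,z_1)(x_2,z_2)=(x_1+x_2,z_1+z_2+f(x_1,x_2))$. $G(f)$ is the group of all $K$-linear $g\in\mathrm{GL}(V)$ with $f(xg,yg)=f(x,y)$ for all $x,y\in V$. For $g\in G(f)$, $I(g)$ is the image of $1-g$ on $V$. The central element $(0,1)$ acts under $\rho$ as a scalar $\epsilon\in K'$, a primitive $p$-th root of unity (so the characteristic of $K'$ is not $p$). For $g\in G(f)$ define $$s(g)=|V|^{-1}\sum_{y\in V}\rho(y,0)\rho(yg,0)^{-1};$$ each $s(g)$ is invertible, and the factor set $\sigma\colon G(f)\times G(f)\to K'\setminus\{0\}$ is defined by $s(g)s(h)=\sigma(g,h)s(gh)$. *)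

theory Defs
  imports
    "HOL-Algebra.Group"
    "HOL-Algebra.Algebraic_Closure_Type"
    "HOL-Library.Function_Algebras"
    "HOL-Library.Product_Plus"
    "Berlekamp_Zassenhaus.Finite_Field"
begin

section \<open>Linear algebra\<close>

definition is_basis :: "('f::field \<Rightarrow> 'v::ab_group_add \<Rightarrow> 'v) \<Rightarrow> 'v set \<Rightarrow> bool" where
  "is_basis sc B \<longleftrightarrow> \<not> module.dependent sc B \<and> module.span sc B = UNIV"

definition finite_dim :: "('f::field \<Rightarrow> 'v::ab_group_add \<Rightarrow> 'v) \<Rightarrow> bool" where
  "finite_dim sc \<longleftrightarrow> (\<exists>B. finite B \<and> is_basis sc B)"

text \<open>The trace of an endomorphism of a finite-dimensional space does not depend on the basis.\<close>

definition lin_trace :: "('f::field \<Rightarrow> 'v::ab_group_add \<Rightarrow> 'v) \<Rightarrow> ('v \<Rightarrow> 'v) \<Rightarrow> 'f" where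
  "lin_trace sc A =
     (let B = (SOME B. is_basis sc B) in \<Sum>b\<in>B. module.representation sc B (A b) b)"

text \<open>
  Linear maps act on the right, so a product \<open>A B\<close> of maps means first \<open>A\<close>, then \<open>B\<close>.
\<close>

definition GL :: "('f::field \<Rightarrow> 'v::ab_group_add \<Rightarrow> 'v) \<Rightarrow> ('v \<Rightarrow> 'v) monoid" where
  "GL sc = \<lparr>carrier = {A. Vector_Spaces.linear sc sc A \<and> bij A},
            monoid.mult = (\<lambda>A B. B \<circ> A), monoid.one = id\<rparr>"

section \<open>The prime field and the trace map\<close>

text \<open>
  The prime field is \<^typ>\<open>'p mod_ring\<close>, where \<open>CARD('p) = p\<close>. A vector space over a field of
  characteristic \<open>p\<close> is regarded as a space over the prime field by restriction of scalars.
\<close>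

definition prime_scale ::
    "('k::field \<Rightarrow> 'w::ab_group_add \<Rightarrow> 'w) \<Rightarrow> 'p::prime_card mod_ring \<Rightarrow> 'w \<Rightarrow> 'w" where
  "prime_scale sc c = sc (of_int (to_int_mod_ring c))"

definition abs_trace :: "'k::field \<Rightarrow> 'p::prime_card mod_ring" where
  "abs_trace a = lin_trace (prime_scale (*)) (\<lambda>x. x * a)"

section \<open>The space \<open>V\<close>, the form \<open>f\<close>, and the groups \<open>E(f)\<close> and \<open>G(f)\<close>\<close>

text \<open>
  Elements of \<open>V = W\<^sup>* \<oplus> W\<close> are pairs \<open>(\<alpha>, x)\<close> of a linear functional and a vector; addition is
  componentwise, and pointwise on functionals.
\<close>

type_synonym ('k, 'w) dbl = "('w \<Rightarrow> 'k) \<times> 'w"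

definition dual_space :: "('k::field \<Rightarrow> 'w::ab_group_add \<Rightarrow> 'w) \<Rightarrow> ('w \<Rightarrow> 'k) set" where
  "dual_space sW = {\<alpha>. Vector_Spaces.linear sW (*) \<alpha>}"

definition dbl_space :: "('k::field \<Rightarrow> 'w::ab_group_add \<Rightarrow> 'w) \<Rightarrow> ('k, 'w) dbl set" where
  "dbl_space sW = dual_space sW \<times> UNIV"

definition dbl_scale ::
    "('k::field \<Rightarrow> 'w::ab_group_add \<Rightarrow> 'w) \<Rightarrow> 'k \<Rightarrow> ('k, 'w) dbl \<Rightarrow> ('k, 'w) dbl" where
  "dbl_scale sW c v = ((\<lambda>w. c * fst v w), sW c (snd v))"

definition W_in_dbl :: "('k::field, 'w) dbl set" where
  "W_in_dbl = {0} \<times> UNIV"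

definition trace_form ::
    "('k::field, 'w) dbl \<Rightarrow> ('k, 'w) dbl \<Rightarrow> 'p::prime_card mod_ring" where
  "trace_form u v = abs_trace (fst v (snd u))"

definition extraspecial ::
    "('k::field \<Rightarrow> 'w::ab_group_add \<Rightarrow> 'w) \<Rightarrow>
     (('k, 'w) dbl \<Rightarrow> ('k, 'w) dbl \<Rightarrow> 'p::prime_card mod_ring) \<Rightarrow>
     (('k, 'w) dbl \<times> 'p mod_ring) monoid" where
  "extraspecial sW f =
     \<lparr>carrier = dbl_space sW \<times> UNIV,
      monoid.mult = (\<lambda>a b. (fst a + fst b, snd a + snd b + f (fst a) (fst b))),
      monoid.one = (0, 0)\<rparr>"

text \<open>
  As \<open>V\<close> is a proper subset of its type, its automorphisms are taken to be \<^const>\<open>extensional\<close>,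
  so that equality of group elements is equality of maps on \<open>V\<close>.
\<close>

definition isometry_group ::
    "('k::field \<Rightarrow> 'w::ab_group_add \<Rightarrow> 'w) \<Rightarrow>
     (('k, 'w) dbl \<Rightarrow> ('k, 'w) dbl \<Rightarrow> 'p::prime_card mod_ring) \<Rightarrow>
     (('k, 'w) dbl \<Rightarrow> ('k, 'w) dbl) monoid" where
  "isometry_group sW f = (let V = dbl_space sW in
     \<lparr>carrier = {g \<in> extensional V. bij_betw g V V \<and>
        (\<forall>x\<in>V. \<forall>y\<in>V. g (x + y) = g x + g y) \<and>
        (\<forall>c. \<forall>x\<in>V. g (dbl_scale sW c x) = dbl_scale sW c (g x)) \<and>
        (\<forall>x\<in>V. \<forall>y\<in>V. f (g x) (g y) = f x y)},
      monoid.mult = (\<lambda>g h. compose V h g), monoid.one = (\<lambda>x\<in>V. x)\<rparr>)"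

definition I_img ::
    "('k::field \<Rightarrow> 'w::ab_group_add \<Rightarrow> 'w) \<Rightarrow>
     (('k, 'w) dbl \<Rightarrow> ('k, 'w) dbl) \<Rightarrow> ('k, 'w) dbl set" where
  "I_img sW g = (\<lambda>v. v - g v) ` dbl_space sW"

definition j_dim ::
    "('k::field \<Rightarrow> 'w::ab_group_add \<Rightarrow> 'w) \<Rightarrow> (('k, 'w) dbl \<Rightarrow> ('k, 'w) dbl) \<Rightarrow> nat" where
  "j_dim sW g = vector_space.dim (dbl_scale sW) (I_img sW g \<inter> W_in_dbl)"

section \<open>Absolutely irreducible representations\<close>

text \<open>
  Let \<open>B\<close> be a finite basis of a space over \<open>'l\<close> and let \<open>\<iota>\<close> embed \<open>'l\<close> into a field \<open>'m\<close>. The space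
  obtained by extending the scalars to \<open>'m\<close> is given in coordinates, as the functions \<open>B \<rightarrow> 'm\<close>,
  extended by \<open>0\<close> outside \<open>B\<close>. An operator acts on such a row vector through its matrix, whose
  row \<open>a\<close> holds the coordinates of the image of the basis vector \<open>a\<close>.
\<close>

definition ext_space :: "'v set \<Rightarrow> ('v \<Rightarrow> 'm::field) set" where
  "ext_space B = {u. \<forall>b. b \<notin> B \<longrightarrow> u b = 0}"

definition ext_op ::
    "('l::field \<Rightarrow> 'v::ab_group_add \<Rightarrow> 'v) \<Rightarrow> ('l \<Rightarrow> 'm::field) \<Rightarrow> 'v set \<Rightarrow>
     ('v \<Rightarrow> 'v) \<Rightarrow> ('v \<Rightarrow> 'm) \<Rightarrow> ('v \<Rightarrow> 'm)" where
  "ext_op sc \<iota> B A u = (\<lambda>b. \<Sum>a\<in>B. u a * \<iota> (module.representation sc B (A a) b))"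

definition irreducible_ops ::
    "('m::field \<Rightarrow> 'u::ab_group_add \<Rightarrow> 'u) \<Rightarrow> 'u set \<Rightarrow> ('u \<Rightarrow> 'u) set \<Rightarrow> bool" where
  "irreducible_ops sc U S \<longleftrightarrow> U \<noteq> {0} \<and>
     (\<forall>U'. U' \<subseteq> U \<and> module.subspace sc U' \<and> (\<forall>A\<in>S. A ` U' \<subseteq> U') \<longrightarrow> U' = {0} \<or> U' = U)"

text \<open>
  A finite-dimensional representation is absolutely irreducible if it stays irreducible after
  extension of scalars to the algebraic closure. This does not depend on the basis used.
\<close>

definition abs_irreducible ::
    "('l::field \<Rightarrow> 'v::ab_group_add \<Rightarrow> 'v) \<Rightarrow> ('g, 'x) monoid_scheme \<Rightarrow> ('g \<Rightarrow> 'v \<Rightarrow> 'v) \<Rightarrow> bool" where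
  "abs_irreducible sc G \<rho> \<longleftrightarrow> (\<exists>B. finite B \<and> is_basis sc B \<and>
     irreducible_ops (\<lambda>c u b. c * u b) (ext_space B :: ('v \<Rightarrow> 'l alg_closure) set)
       ((\<lambda>x. ext_op sc to_ac B (\<rho> x)) ` carrier G))"

section \<open>The factor set of a representation of \<open>E(f)\<close>\<close>

definition central_scalar ::
    "('l::field \<Rightarrow> 'v::ab_group_add \<Rightarrow> 'v) \<Rightarrow>
     (('k::field, 'w::ab_group_add) dbl \<times> 'p::prime_card mod_ring \<Rightarrow> 'v \<Rightarrow> 'v) \<Rightarrow> 'l" where
  "central_scalar sV' \<rho> = (THE \<epsilon>. \<rho> (0, 1) = sV' \<epsilon>)"

definition s_op ::
    "('k::field \<Rightarrow> 'w::ab_group_add \<Rightarrow> 'w) \<Rightarrow> ('l::field \<Rightarrow> 'v::ab_group_add \<Rightarrow> 'v) \<Rightarrow>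
     (('k, 'w) dbl \<times> 'p::prime_card mod_ring \<Rightarrow> 'v \<Rightarrow> 'v) \<Rightarrow>
     (('k, 'w) dbl \<Rightarrow> ('k, 'w) dbl) \<Rightarrow> 'v \<Rightarrow> 'v" where
  "s_op sW sV' \<rho> g v = sV' (inverse (of_nat (card (dbl_space sW))))
     (\<Sum>y\<in>dbl_space sW. (\<rho> (y, 0) \<otimes>\<^bsub>GL sV'\<^esub> inv\<^bsub>GL sV'\<^esub> (\<rho> (g y, 0))) v)"

definition factor_set ::
    "('k::field \<Rightarrow> 'w::ab_group_add \<Rightarrow> 'w) \<Rightarrow> ('l::field \<Rightarrow> 'v::ab_group_add \<Rightarrow> 'v) \<Rightarrow>
     (('k, 'w) dbl \<Rightarrow> ('k, 'w) dbl \<Rightarrow> 'p::prime_card mod_ring) \<Rightarrow>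
     (('k, 'w) dbl \<times> 'p mod_ring \<Rightarrow> 'v \<Rightarrow> 'v) \<Rightarrow>
     (('k, 'w) dbl \<Rightarrow> ('k, 'w) dbl) \<Rightarrow> (('k, 'w) dbl \<Rightarrow> ('k, 'w) dbl) \<Rightarrow> 'l" where
  "factor_set sW sV' f \<rho> g h = (THE c. c \<noteq> 0 \<and>
     s_op sW sV' \<rho> g \<otimes>\<^bsub>GL sV'\<^esub> s_op sW sV' \<rho> h =
     (\<lambda>v. sV' c (s_op sW sV' \<rho> (g \<otimes>\<^bsub>isometry_group sW f\<^esub> h) v)))"

definition field_automorphism :: "('l::field \<Rightarrow> 'l) \<Rightarrow> bool" where
  "field_automorphism \<eta> \<longleftrightarrow> bij \<eta> \<and> \<eta> 1 = 1 \<and>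
     (\<forall>a b. \<eta> (a + b) = \<eta> a + \<eta> b) \<and> (\<forall>a b. \<eta> (a * b) = \<eta> a * \<eta> b)"

end

theory Submission
  imports Defs
begin

text \<open>
  Since \<open>0 \<oplus> W\<close> and \<open>W\<^sup>* \<oplus> 0\<close> are the radicals of \<open>f\<close>, an isometry \<open>g\<close> is a pair
  consisting of an automorphism \<open>a\<close> of \<open>W\<close> and its contragredient, and \<open>I(g) \<inter> W\<close> is the
  image of \<open>1 - a\<close>. Let \<open>E\<^sub>x\<close> be the space of vectors on which \<open>\<rho>(\<beta>, 0)\<close> acts as
  \<open>\<epsilon>\<close> to the power \<open>T(x\<beta>)\<close>, for all \<open>\<beta> \<in> W\<^sup>*\<close>. These spaces span \<open>V'\<close>, and
  \<open>\<rho>(0, y)\<close> maps \<open>E\<^sub>x\<close> to \<open>E\<^sub>x\<^sub>+\<^sub>y\<close>. Summing over \<open>\<beta>\<close> first shows that \<open>s(g)\<close> acts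
  on \<open>E\<^sub>x\<close> as \<open>\<rho>(0, xa - x)\<close> times \<open>|ker (1 - a)| / |W| = \<mu>(g)\<close>; hence
  \<open>g \<mapsto> \<mu>(g)\<^sup>-\<^sup>1 s(g)\<close> is multiplicative. The orthogonality relations used for this need the
  center to act by a nontrivial character, which is Schur's lemma together with
  \<open>dim V' > 1\<close>, and the nondegeneracy of the trace map.
\<close>

section \<open>Finite vector spaces and traces\<close>

text \<open>Sums and products of representatives get reduced modulo p, and the reduction disappears
  in a ring of characteristic p. This makes \<open>prime_scale\<close> a restriction of
  scalars.\<close>

lemma of_int_to_int_mod_ring:
  fixes a b :: "'p::prime_card mod_ring"
  assumes "CHAR('k::comm_ring_1) = CARD('p)"
  shows "(of_int (to_int_mod_ring (a + b)) :: 'k) = of_int (to_int_mod_ring a) + of_int (to_int_mod_ring b)"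
    and "(of_int (to_int_mod_ring (a * b)) :: 'k) = of_int (to_int_mod_ring a) * of_int (to_int_mod_ring b)"
  using assms of_int_mod_CHAR[where 'a='k]
  by (simp_all add: to_int_mod_ring_add to_int_mod_ring_mult flip: of_int_add of_int_mult)

lemma vector_space_prime_scale:
  fixes sc :: "'k::field \<Rightarrow> 'v::ab_group_add \<Rightarrow> 'v"
  assumes "vector_space sc" "CHAR('k) = CARD('p::prime_card)"
  shows "vector_space (prime_scale sc :: 'p mod_ring \<Rightarrow> 'v \<Rightarrow> 'v)"
proof -
  interpret vector_space sc by fact
  have "to_int_mod_ring (1 :: 'p mod_ring) = 1" by transfer simp
  then show ?thesis
    unfolding vector_space_def prime_scale_def
    by (simp add: of_int_to_int_mod_ring[OF assms(2)] scale_right_distrib scale_left_distrib)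
qed

text \<open>Induction on B: the map (c, v) to c b + v sends scalars times the old span onto the new
  span, and it is injective when b lies outside the old span. So each basis vector contributes a
  factor |K|.\<close>

lemma finite_span_and_card:
  fixes sc :: "'k::field \<Rightarrow> 'v::ab_group_add \<Rightarrow> 'v"
  assumes "vector_space sc" "finite (UNIV :: 'k set)" "finite B" 
  shows "finite (module.span sc B)" 
    and "\<not> module.dependent sc B \<Longrightarrow> card (module.span sc B) = CARD('k) ^ card B"
proof -
  interpret vector_space sc by fact
  have *: "span (insert b B) = (\<lambda>(c, v). sc c b + v) ` (UNIV \<times> span B)" for b B
  proof (intro equalityI subsetI)
    fix x assume "x \<in> span (insert b B)"
    then obtain k where "x - sc k b \<in> span B" by (auto simp: span_breakdown_eq)
    then show "x \<in> (\<lambda>(c, v). sc c b + v) ` (UNIV \<times> span B)"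
      by (intro image_eqI[where x = "(k, x - sc k b)"]) auto
  next
    fix x assume "x \<in> (\<lambda>(c, v). sc c b + v) ` (UNIV \<times> span B)"
    then obtain c v where "x = sc c b + v" "v \<in> span B" by auto
    then show "x \<in> span (insert b B)"
      unfolding span_breakdown_eq by (intro exI[of _ c]) simp
  qed
  have "finite (span B) \<and> (independent B \<longrightarrow> card (span B) = CARD('k) ^ card B)"
    using assms(3)
  proof induction
    case (insert b B)
    have "card (span (insert b B)) = CARD('k) ^ card (insert b B)" if ind: "independent (insert b B)"
    proof -
      have b: "b \<notin> span B" "independent B"
        using ind insert.hyps by (auto simp: independent_insert)
      have "inj_on (\<lambda>(c, v). sc c b + v) (UNIV \<times> span B)"
      proof (intro inj_onI; clarify)
        fix c v c' v' assume v: "v \<in> span B" "v' \<in> span B" and eq: "sc c b + v = sc c' b + v'"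
        have e: "sc (c - c') b = v' - v" using eq by (simp add: scale_left_diff_distrib algebra_simps)
        have "c = c'"
        proof (rule ccontr)
          assume "c \<noteq> c'"
          then have "b = sc (inverse (c - c')) (v' - v)" by (simp flip: e)
          then show False using b(1) v by (metis span_diff span_scale)
        qed
        with eq show "c = c' \<and> v = v'" by simp
      qed
      then show ?thesis
        using insert b by (simp add: * card_image card_cartesian_product)
    qed
    then show ?case using insert assms(2) by (simp add: *)
  qed simp
  then show "finite (span B)" "independent B \<Longrightarrow> card (span B) = CARD('k) ^ card B" by auto
qed

lemma card_subspace:
  fixes sc :: "'k::field \<Rightarrow> 'v::ab_group_add \<Rightarrow> 'v"
  assumes "vector_space sc" "finite (UNIV :: 'k set)" "finite S" "module.subspace sc S"
  shows "card S = CARD('k) ^ vector_space.dim sc S"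
proof -
  interpret vector_space sc by fact
  obtain B where B: "B \<subseteq> S" "independent B" "S \<subseteq> span B" "card B = dim S"
    using basis_exists by blast
  have "span B = S" using B assms(4) by (simp add: span_minimal subset_antisym)
  then show ?thesis
    using finite_span_and_card(2)[OF assms(1,2) finite_subset[OF B(1) assms(3)] B(2)] B(4) by simp
qed

lemma is_basis_some:
  assumes "vector_space sc"
  shows "is_basis sc (SOME B. is_basis sc B)"
proof -
  interpret vector_space sc by fact
  obtain B where "independent B" "UNIV \<subseteq> span B" using basis_exists[of UNIV] by blast
  then have "is_basis sc B" by (auto simp: is_basis_def)
  then show ?thesis by (rule someI)
qed

lemma (in vector_space) representation_linear:
  assumes "finite B" "independent B" "span B = UNIV" "Vector_Spaces.linear scale scale A"
  shows "representation B (A v) b = (\<Sum>c\<in>B. representation B v c * representation B (A c) b)"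
proof -
  interpret A: Vector_Spaces.linear scale scale A by fact
  have "A v = (\<Sum>c\<in>B. scale (representation B v c) (A c))"
    using sum_representation_eq[OF assms(2) _ assms(1), of v] assms(3)
    by (metis (no_types, lifting) A.scale A.sum UNIV_I subset_refl sum.cong)
  then show ?thesis using assms by (simp add: representation_sum representation_scale)
qed

section \<open>Traces of endomorphisms of a finite space\<close>

context
  fixes sc :: "'k::field \<Rightarrow> 'v::ab_group_add \<Rightarrow> 'v"
  assumes vs: "vector_space sc" and fin: "finite (UNIV :: 'v set)"
begin

interpretation vector_space sc by (fact vs)

lemma lin_trace_eq:
  obtains B where "finite B" "independent B" "span B = UNIV"
    "\<And>A. lin_trace sc A = (\<Sum>b\<in>B. representation B (A b) b)"
  using is_basis_some[OF vs] finite_subset[OF subset_UNIV fin]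
  by (auto simp: is_basis_def lin_trace_def Let_def)

lemma lin_trace_sum:
  "lin_trace sc (\<lambda>x. \<Sum>i\<in>I. A i x) = (\<Sum>i\<in>I. lin_trace sc (A i))"
proof -
  obtain B where B: "finite B" "independent B" "span B = UNIV"
    and tr: "\<And>A. lin_trace sc A = (\<Sum>b\<in>B. representation B (A b) b)" by (rule lin_trace_eq) blast
  show ?thesis unfolding tr using B 
    by (subst sum.swap) (simp add: representation_sum)
qed

text \<open>Both sides are the same double sum of products of matrix entries, with the order of
  summation exchanged.\<close>

lemma lin_trace_commute:
  assumes "Vector_Spaces.linear sc sc A" "Vector_Spaces.linear sc sc C"
  shows "lin_trace sc (\<lambda>x. A (C x)) = lin_trace sc (\<lambda>x. C (A x))"
proof -
  obtain B where B: "finite B" "independent B" "span B = UNIV"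
    and tr: "\<And>A. lin_trace sc A = (\<Sum>b\<in>B. representation B (A b) b)" by (rule lin_trace_eq) blast
  show ?thesis unfolding tr representation_linear[OF B assms(1), where v = "C _"]
      representation_linear[OF B assms(2), where v = "A _"]
    by (subst sum.swap) (simp add: mult.commute)
qed

text \<open>The diagonal entry at b is t b times the b-coordinate of e, and these add up to t
  applied to the expansion of e.\<close>

lemma lin_trace_rank_one:
  assumes "Vector_Spaces.linear sc (*) t"
  shows "lin_trace sc (\<lambda>x. sc (t x) e) = t e"
proof -
  obtain B where B: "finite B" "independent B" "span B = UNIV"
    and tr: "\<And>A. lin_trace sc A = (\<Sum>b\<in>B. representation B (A b) b)" by (rule lin_trace_eq) blast
  interpret t: Vector_Spaces.linear sc "(*)" t by fact
  have "t e = t (\<Sum>b\<in>B. sc (representation B e b) b)"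
    using sum_representation_eq[OF B(2) _ B(1), of e] B(3) by simp
  also have "\<dots> = (\<Sum>b\<in>B. representation B e b * t b)" by (simp add: t.sum t.scale)
  finally show ?thesis unfolding tr using B by (simp add: representation_scale mult.commute)
qed

end

section \<open>Frobenius maps and nontriviality of the trace map\<close>

lemma exists_nonroot:
  fixes P :: "'k::{finite, idom} poly"
  assumes "P \<noteq> 0" "degree P < CARD('k)"
  obtains x where "poly P x \<noteq> 0"
  using card_poly_roots_bound[OF assms(1)] assms(2) by (cases "{x. poly P x = 0} = UNIV") auto

lemma CARD_power_of_prime:
  assumes "CHAR('k::finite_field) = CARD('p::prime_card)"
  obtains m where "m > 0" "CARD('k::finite_field) = CARD('p::prime_card) ^ m"
proof -
  let ?sc = "prime_scale (*) :: 'p mod_ring \<Rightarrow> 'k \<Rightarrow> 'k"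
  interpret K: vector_space "(*) :: 'k \<Rightarrow> 'k \<Rightarrow> 'k" by unfold_locales (simp_all add: algebra_simps)
  have "vector_space ?sc" by (rule vector_space_prime_scale) (use assms K.vector_space_axioms in auto)
  then interpret vector_space ?sc .
  have card: "CARD('k) = CARD('p) ^ dim UNIV"
    using card_subspace[OF vector_space_axioms, of UNIV] by simp
  have "CARD('k) > 1" using card_mono[of "UNIV :: 'k set" "{0, 1}"] by simp
  then have "dim UNIV > 0" using card by (cases "dim UNIV") auto
  then show ?thesis using that card by blast
qed

text \<open>X^p - X has at most p roots, and the p elements of the prime field are already
  roots.\<close>

lemma fixed_by_frobenius:
  fixes x :: "'k::finite_field"
  assumes "CHAR('k) = CARD('p::prime_card)" "x ^ CARD('p::prime_card) = x"
  obtains c :: "'p::prime_card mod_ring" where "x = of_int (to_int_mod_ring c)"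
proof -
  let ?e = "\<lambda>c :: 'p mod_ring. of_int (to_int_mod_ring c) :: 'k"
  let ?P = "monom 1 (CARD('p)) - monom 1 1 :: 'k poly"
  note hom = of_int_to_int_mod_ring[OF assms(1)]
  have p: "CARD('p) > 1" by (rule prime_gt_1_nat[OF prime_card])
  have one: "?e 1 = 1" by simp
  have pow: "?e c ^ n = ?e (c ^ n)" for c n by (induction n) (auto simp: hom one)
  \<comment> \<open>Nonzero residues are invertible and \<open>?e\<close> is multiplicative, so it
    cannot send a nonzero difference to 0.\<close>
  have "c = c'" if "?e c = ?e c'" for c c'
  proof (rule ccontr)
    assume "c \<noteq> c'"
    have "?e (c - c') = 0" using hom(1)[of "c - c'" c'] that by simp
    then have "?e ((c - c') * inverse (c - c')) = 0" unfolding hom by simp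
    then show False using \<open>c \<noteq> c'\<close> one by simp
  qed
  then have inj: "inj ?e" by (rule injI)
  have "coeff ?P (CARD('p)) \<noteq> 0" using p by simp
  then have P: "?P \<noteq> 0" by (metis coeff_0)
  have "degree ?P \<le> CARD('p)"
    using p by (intro degree_diff_le) (auto intro: order_trans[OF degree_monom_le])
  with card_poly_roots_bound[OF P] have "card {x. poly ?P x = 0} \<le> card (range ?e)"
    using card_image[OF inj] by simp
  moreover have "range ?e \<subseteq> {x. poly ?P x = 0}"
    using finite_field_power_card_eq_same[where 'a = "'p mod_ring"] by (auto simp: poly_monom pow)
  ultimately have "range ?e = {x. poly ?P x = 0}"
    by (intro card_seteq) auto
  moreover have "x \<in> {x. poly ?P x = 0}" using assms(2) by (simp add: poly_monom)
  ultimately show ?thesis using that by blast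
qed

context
  assumes char: "CHAR('k::finite_field) = CARD('p::prime_card)"
begin

abbreviation (input) prime_emb :: "'p mod_ring \<Rightarrow> 'k" where "prime_emb c \<equiv> of_int (to_int_mod_ring c)"
abbreviation (input) prime_smult :: "'p mod_ring \<Rightarrow> 'k \<Rightarrow> 'k" where "prime_smult \<equiv> prime_scale (*)"

lemma vector_space_prime_smult: "vector_space prime_smult"
  by (rule vector_space_prime_scale[OF _ char]) (unfold_locales, simp_all add: algebra_simps)

interpretation P: vector_space prime_smult by (rule vector_space_prime_smult)

lemma prime_smult_linear:
  assumes "\<And>x y. A (x + y) = A x + A y" "\<And>c x. A (prime_emb c * x) = prime_emb c * A x"
  shows "Vector_Spaces.linear prime_smult prime_smult A"
  using assms unfolding Vector_Spaces.linear_iff prime_scale_def[symmetric]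
  by (auto simp: vector_space_prime_smult prime_scale_def)

lemma emb_power_CARD: "prime_emb c ^ (CARD('p) ^ i) = prime_emb c"
proof -
  have one: "prime_emb 1 = 1" by simp
  have "prime_emb c ^ n = prime_emb (c ^ n)" for n by (induction n) (auto simp: of_int_to_int_mod_ring[OF char] one)
  then show ?thesis using finite_field_power_card_power_eq_same[of "CARD('p) ^ i" i c] by simp
qed

text \<open>Additivity is the freshman's dream; scalars pass through because Frobenius powers fix
  the prime field.\<close>

lemma frobenius_linear: "Vector_Spaces.linear prime_smult prime_smult (\<lambda>x. x ^ (CARD('p) ^ i) * c)"
  using char prime_card[where 'a='p]
  by (intro prime_smult_linear) (simp_all add: freshmans_dream' power_mult_distrib emb_power_CARD ring_distribs)

text \<open>A family indexed by \<open>bool\<close> turns \<open>lin_trace_sum\<close> into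
  additivity for two operators.\<close>

lemma abs_trace_add: "(abs_trace (a + b) :: 'p mod_ring) = abs_trace a + abs_trace (b :: 'k)"
  using lin_trace_sum[OF vector_space_prime_smult finite_class.finite_UNIV, of "\<lambda>i x. x * (if i then a else b)" UNIV]
  by (simp add: abs_trace_def UNIV_bool ring_distribs add.commute)

text \<open>
  Conjugating \<open>x \<mapsto> x\<^sup>P c\<close> (with \<open>P = p\<^sup>i\<close>) by multiplication with \<open>b\<close> replaces \<open>c\<close> by
  \<open>c b / b\<^sup>P\<close>, so the trace, an additive function of \<open>c\<close>, vanishes as soon as \<open>b\<^sup>P \<noteq> b\<close>.
\<close>

lemma lin_trace_frobenius:
  assumes i: "i > 0" and less: "CARD('p) ^ i < CARD('k)"
  shows "lin_trace prime_smult (\<lambda>x. x ^ (CARD('p) ^ i) * c) = 0"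
proof -
  define P where "P = CARD('p) ^ i"
  let ?Q = "monom 1 P - monom 1 1 :: 'k poly"
  define \<tau> where "\<tau> c = lin_trace prime_smult (\<lambda>x. x ^ P * c)" for c
  have P: "P > 1" using i prime_gt_1_nat[OF prime_card[where 'a='p]] unfolding P_def by (rule one_less_power[rotated])
  have "coeff ?Q P \<noteq> 0" using P by simp
  then have "?Q \<noteq> 0" by (metis coeff_0)
  moreover have "degree ?Q \<le> P"
    using P by (intro degree_diff_le) (auto intro: order_trans[OF degree_monom_le])
  ultimately obtain b where "poly ?Q b \<noteq> 0"
    using exists_nonroot[of ?Q] less unfolding P_def by (metis le_less_trans)
  then have b: "b ^ P \<noteq> b" by (simp add: poly_monom)
  with P have b0: "b \<noteq> 0" by (auto simp: power_0_left)
  define u where "u = b / b ^ P"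
  have u: "u \<noteq> 1" using b b0 by (simp add: u_def)
  have inv: "\<tau> c = \<tau> (c * u)" for c
  proof -
    have lin: "Vector_Spaces.linear prime_smult prime_smult (\<lambda>x. d * x)" for d by (rule prime_smult_linear) (auto simp: algebra_simps)
    have lin': "Vector_Spaces.linear prime_smult prime_smult (\<lambda>x. (d * x) ^ P * c)" for d
      using Vector_Spaces.linear_compose[OF lin[of d] frobenius_linear[of i c]] by (simp add: o_def P_def)
    have "\<tau> c = lin_trace prime_smult (\<lambda>x. (inverse b * (b * x)) ^ P * c)" using b0 by (simp add: \<tau>_def flip: mult.assoc)
    also have "\<dots> = lin_trace prime_smult (\<lambda>x. b * ((inverse b * x) ^ P * c))"
      by (rule lin_trace_commute[OF vector_space_prime_smult finite_class.finite_UNIV lin' lin])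
    also have "(\<lambda>x. b * ((inverse b * x) ^ P * c)) = (\<lambda>x. x ^ P * (c * u))"
      by (rule ext) (simp add: u_def power_mult_distrib power_inverse field_simps)
    finally show ?thesis by (simp add: \<tau>_def)
  qed
  have add: "\<tau> (c + d) = \<tau> c + \<tau> d" for c d
    using lin_trace_sum[OF vector_space_prime_smult finite_class.finite_UNIV, of "\<lambda>i x. x ^ P * (if i then c else d)" UNIV]
    by (simp add: \<tau>_def UNIV_bool ring_distribs add.commute)
  \<comment> \<open>The witness solves d (1 - u) = c; additivity together with \<open>inv\<close>
    then makes the trace at c vanish.\<close>
  define d where "d = c / (1 - u)"
  have "\<tau> d = \<tau> (d * u) + \<tau> (d * (1 - u))" by (simp flip: add distrib_left)
  then have "\<tau> (d * (1 - u)) = 0" using inv[of d] by simp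
  then show ?thesis using u by (simp add: d_def \<tau>_def P_def)
qed

text \<open>
  If \<open>Tr x\<close> is the sum of the Frobenius conjugates of \<open>x\<close> and \<open>Tr e = 1\<close>, the map
  \<open>x \<mapsto> Tr x \<cdot> e\<close> has rank one and trace \<open>1\<close>, while all its Frobenius components except the
  multiplication by \<open>e\<close> have trace \<open>0\<close>.
\<close>

lemma abs_trace_eq_1: "\<exists>e :: 'k. (abs_trace e :: 'p mod_ring) = 1"
proof -
  let ?p = "CARD('p)"
  have p1: "?p > 1" by (rule prime_gt_1_nat[OF prime_card])
  obtain m where m: "m > 0" "CARD('k) = ?p ^ m" by (rule CARD_power_of_prime[OF char])
  define Tr :: "'k \<Rightarrow> 'k" where "Tr x = (\<Sum>i<m. x ^ (?p ^ i))" for x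
  \<comment> \<open>Raising to the power p moves each exponent p^i to the next one, and x^(p^m) = x
    closes the cycle. Hence \<open>Tr\<close> has values in the prime field.\<close>
  have Tr_fixed: "Tr x ^ ?p = Tr x" for x
  proof -
    have "Tr x ^ ?p = (\<Sum>i<m. x ^ (?p ^ Suc i))"
      using char prime_card[where 'a='p]
      by (simp add: Tr_def freshmans_dream_sum flip: power_mult) (simp add: mult.commute)
    also have "\<dots> + x ^ (?p ^ 0) = (\<Sum>i<Suc m. x ^ (?p ^ i))" by (subst sum.lessThan_Suc_shift) simp
    also have "\<dots> = Tr x + x" using m finite_field_power_card_eq_same[of x] by (simp add: Tr_def)
    finally show ?thesis by simp
  qed
  have Tr_add: "Tr (x + y) = Tr x + Tr y" for x y
    using char prime_card[where 'a='p] by (simp add: Tr_def freshmans_dream' sum.distrib)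
  have fixed_power: "k ^ (?p ^ i) = k" if "k ^ ?p = k" for k :: 'k and i
    using that by (induction i) (simp_all add: power_mult)
  have Tr_scale: "Tr (k * x) = k * Tr x" if "k ^ ?p = k" for k x
    by (simp add: Tr_def power_mult_distrib fixed_power[OF that] sum_distrib_left)
  \<comment> \<open>As a polynomial, \<open>Tr\<close> has coefficient 1 at X and degree at most
    p^(m-1) < |K|, so it cannot vanish on all of K.\<close>
  have "\<exists>x. Tr x \<noteq> 0"
  proof -
    let ?P = "\<Sum>i<m. monom 1 (?p ^ i) :: 'k poly"
    have "coeff ?P 1 = (\<Sum>i<m. if i = 0 then 1 else 0)"
      using p1 by (auto simp: coeff_sum intro!: sum.cong)
    then have "coeff ?P 1 \<noteq> 0" using m(1) by simp
    then have "?P \<noteq> 0" by (metis coeff_0)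
    moreover have "degree ?P \<le> ?p ^ (m - 1)"
      using p1 by (intro degree_sum_le) (auto intro!: order_trans[OF degree_monom_le] power_increasing)
    moreover have "?p ^ (m - 1) < CARD('k)" using p1 m by (simp add: power_strict_increasing)
    ultimately obtain x where "poly ?P x \<noteq> 0" using exists_nonroot[of ?P] by (metis le_less_trans)
    then show ?thesis by (auto simp: Tr_def poly_sum poly_monom)
  qed
  then obtain x where x: "Tr x \<noteq> 0" by blast
  define e where "e = inverse (Tr x) * x"
  have e: "Tr e = 1" using x Tr_scale[of "inverse (Tr x)" x] Tr_fixed by (simp add: e_def power_inverse)
  have "\<forall>x. \<exists>c. Tr x = prime_emb c" using fixed_by_frobenius[OF char Tr_fixed] by metis
  \<comment> \<open>\<open>t\<close> is \<open>Tr\<close> read as a functional with values in the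
    type of the prime field.\<close>
  then obtain t where t: "Tr x = prime_emb (t x)" for x by metis
  have emb_inj: "c = d" if "prime_emb c = prime_emb d" for c d
    using that P.scale_right_imp_eq[of "1::'k" c d] by (simp add: prime_scale_def)
  have one: "prime_emb 1 = 1" by simp
  have "Vector_Spaces.linear prime_smult (*) t"
    unfolding Vector_Spaces.linear_iff
  proof (intro conjI allI)
    show "vector_space prime_smult" by (rule vector_space_prime_smult)
    show "vector_space ((*) :: 'p mod_ring \<Rightarrow> _)" by unfold_locales (simp_all add: algebra_simps)
    show "t (x + y) = t x + t y" for x y
      by (rule emb_inj) (simp add: of_int_to_int_mod_ring[OF char] Tr_add flip: t)
    show "t (prime_smult c x) = c * t x" for c x
      by (rule emb_inj) (use Tr_scale[of "prime_emb c" x] emb_power_CARD[of c 1] in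
          \<open>simp add: of_int_to_int_mod_ring[OF char] prime_scale_def flip: t\<close>)
  qed
  then have "t e = lin_trace prime_smult (\<lambda>x. prime_smult (t x) e)"
    by (rule lin_trace_rank_one[OF vector_space_prime_smult finite_class.finite_UNIV, symmetric])
  also have "(\<lambda>x. prime_smult (t x) e) = (\<lambda>x. \<Sum>i<m. x ^ (?p ^ i) * e)"
    by (rule ext) (simp add: prime_scale_def flip: t, simp add: Tr_def sum_distrib_right)
  also have "lin_trace prime_smult \<dots> = (\<Sum>i<m. lin_trace prime_smult (\<lambda>x. x ^ (?p ^ i) * e))"
    by (rule lin_trace_sum[OF vector_space_prime_smult finite_class.finite_UNIV])
  also have "\<dots> = (\<Sum>i<m. if i = 0 then abs_trace e else 0)"
    using p1 m lin_trace_frobenius by (intro sum.cong) (auto simp: abs_trace_def power_strict_increasing)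
  also have "\<dots> = abs_trace e" using m(1) by simp
  finally have "abs_trace e = t e" by simp
  also have "t e = 1" by (rule emb_inj) (simp add: one e flip: t)
  finally show ?thesis by blast
qed

end

section \<open>Schur's lemma for operators of finite order\<close>

text \<open>Split off a root, P = (X - r) Q, and put w = Q(A) u. Either w is nonzero and an
  eigenvector for r, or Q annihilates u and has smaller degree. A nonzero constant cannot annihilate
  u, so the descent stops.\<close>

lemma eigenvector_of_annihilating_poly:
  fixes s :: "'m::alg_closed_field \<Rightarrow> 'u::ab_group_add \<Rightarrow> 'u"
  assumes lin: "Vector_Spaces.linear s s A" and U: "module.subspace s U" "A ` U \<subseteq> U"
    and u: "u \<in> U" "u \<noteq> 0"
    and "P \<noteq> 0" "(\<Sum>i\<le>degree P. s (coeff P i) ((A ^^ i) u)) = 0"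
  shows "\<exists>l w. w \<in> U \<and> w \<noteq> 0 \<and> A w = s l w"
  using assms(6,7)
proof (induction "degree P" arbitrary: P)
  interpret A: Vector_Spaces.linear s s A by fact
  case 0
  then have "coeff P 0 \<noteq> 0" using leading_coeff_0_iff[of P] by metis
  then show ?case using 0 u by simp
next
  interpret A: Vector_Spaces.linear s s A by fact
  case (Suc n)
  obtain r where "poly P r = 0" using alg_closed_imp_poly_has_root[of P] Suc.hyps(2) by auto
  then obtain Q where Q: "P = [:-r, 1:] * Q" by (auto simp: poly_eq_0_iff_dvd elim: dvdE)
  with Suc.prems have Q0: "Q \<noteq> 0" by auto
  have deg: "degree Q = n" using Suc.hyps(2) Q0 unfolding Q by (subst (asm) degree_mult_eq) auto
  define w where "w = (\<Sum>i\<le>n. s (coeff Q i) ((A ^^ i) u))"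
  have Aw: "A w = (\<Sum>i\<le>Suc n. s (coeff (pCons 0 Q) i) ((A ^^ i) u))"
    unfolding w_def by (subst sum.atMost_Suc_shift) (simp add: A.sum A.scale)
  \<comment> \<open>Q has degree n, so the added term at n + 1 is zero; now the sums for X Q and for
    Q have the same range and can be subtracted termwise.\<close>
  have w': "w = (\<Sum>i\<le>Suc n. s (coeff Q i) ((A ^^ i) u))"
    using deg by (simp add: w_def coeff_eq_0)
  have coeff: "coeff P i = coeff (pCons 0 Q) i - r * coeff Q i" for i unfolding Q by simp
  have "A w - s r w = (\<Sum>i\<le>Suc n. s (coeff P i) ((A ^^ i) u))"
    unfolding Aw by (subst w') (simp only: coeff A.vs1.scale_left_diff_distrib sum_subtractf A.vs1.scale_sum_right A.vs1.scale_scale)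
  with Suc have Aw: "A w = s r w" by simp
  have "(A ^^ i) u \<in> U" for i using U(2) u(1) by (induction i) auto
  then have "w \<in> U" unfolding w_def by (intro A.vs1.subspace_sum A.vs1.subspace_scale U(1))
  show ?case
  proof (cases "w = 0")
    case True
    then show ?thesis using Suc.hyps(1)[of Q] deg Q0 by (simp add: w_def)
  qed (use Aw \<open>w \<in> U\<close> in blast)
qed

text \<open>X^N - 1 annihilates u. Repeated roots do no harm, which matters because the case N = p
  is used before p is known to be nonzero in K'.\<close>

lemma eigenvector_of_finite_order:
  fixes s :: "'m::alg_closed_field \<Rightarrow> 'u::ab_group_add \<Rightarrow> 'u"
  assumes "Vector_Spaces.linear s s A" "module.subspace s U" "A ` U \<subseteq> U"
    and "u \<in> U" "u \<noteq> 0" and N: "N > 0" "(A ^^ N) u = u"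
  shows "\<exists>l w. w \<in> U \<and> w \<noteq> 0 \<and> A w = s l w"
proof (rule eigenvector_of_annihilating_poly[OF assms(1-5)])
  interpret A: Vector_Spaces.linear s s A by fact
  let ?P = "monom 1 N - 1 :: 'm poly"
  have "coeff ?P N = 1" using N(1) by simp
  then show "?P \<noteq> 0" by (metis coeff_0 zero_neq_one)
  have deg: "degree ?P = N"
    using N(1) \<open>coeff ?P N = 1\<close> by (intro antisym degree_diff_le le_degree) (auto simp: degree_monom_le)
  have "(\<Sum>i\<le>N. s (coeff ?P i) ((A ^^ i) u))
    = (\<Sum>i\<le>N. (if i = N then (A ^^ i) u else 0) - (if i = 0 then (A ^^ i) u else 0))"
    using N(1) by (intro sum.cong) (auto simp: coeff_1)
  also have "\<dots> = 0" using N by (simp add: sum_subtractf)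
  finally show "(\<Sum>i\<le>degree ?P. s (coeff ?P i) ((A ^^ i) u)) = 0" unfolding deg .
qed

lemma vector_space_fun: "vector_space (\<lambda>c (u :: 'v \<Rightarrow> 'm::field) b. c * u b)"
  by unfold_locales (auto simp: algebra_simps)

section \<open>Extension of scalars to the algebraic closure\<close>

context
  fixes sc :: "'l::field \<Rightarrow> 'v::ab_group_add \<Rightarrow> 'v" and B :: "'v set"
  assumes vs: "vector_space sc" and fin: "finite B" and basis: "is_basis sc B"
begin

interpretation vector_space sc by (fact vs)

abbreviation (input) "ext \<equiv> ext_op sc (to_ac :: 'l \<Rightarrow> 'l alg_closure) B"
abbreviation (input) "fun_scale \<equiv> (\<lambda>c (u :: 'v \<Rightarrow> 'l alg_closure) b. c * u b)"

lemma basisD: "independent B" "span B = UNIV"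
  using basis by (auto simp: is_basis_def)

lemma ext_op_linear: "Vector_Spaces.linear fun_scale fun_scale (ext A)"
  unfolding Vector_Spaces.linear_iff
  by (auto simp: vector_space_fun ext_op_def fun_eq_iff algebra_simps sum.distrib sum_distrib_left)

lemma ext_op_closed: "ext A u \<in> ext_space B"
proof -
  have "representation B v b = 0" if "b \<notin> B" for v b using representation_ne_zero that by metis
  then show ?thesis by (simp add: ext_space_def ext_op_def)
qed

lemma ext_op_comp:
  assumes "Vector_Spaces.linear sc sc C"
  shows "ext (C \<circ> A) u = ext C (ext A u)"
  unfolding ext_op_def o_def representation_linear[OF fin basisD assms, where v = "A _"]
  by (rule ext, simp add: to_ac_sum sum_distrib_left sum_distrib_right mult.assoc) (rule sum.swap)

text \<open>Off B the left side is 0 by construction, which is why u has to lie in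
  \<open>ext_space B\<close>.\<close>

lemma ext_op_scale:
  assumes "u \<in> ext_space B"
  shows "ext (sc c) u = fun_scale (to_ac c) u"
proof
  fix b
  have "ext (sc c) u b = (\<Sum>a\<in>B. if a = b then to_ac c * u b else 0)"
    unfolding ext_op_def using basisD
    by (intro sum.cong) (auto simp: representation_scale representation_basis)
  also have "\<dots> = to_ac c * u b" using assms fin by (auto simp: ext_space_def)
  finally show "ext (sc c) u b = to_ac c * u b" .
qed

lemma ext_op_id: "u \<in> ext_space B \<Longrightarrow> ext id u = u"
proof -
  have "sc 1 = id" by auto
  then show "u \<in> ext_space B \<Longrightarrow> ext id u = u" using ext_op_scale[of u 1] by simp
qed

lemma subspace_ext_space: "module.subspace fun_scale (ext_space B)"
proof -
  interpret X: vector_space fun_scale by (rule vector_space_fun)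
  show ?thesis by (auto simp: X.subspace_def ext_space_def)
qed

text \<open>Descent from the closure: evaluation at unit vectors shows that the matrix of Z is
  diagonal with entry l everywhere. Matrix entries come from the base field and \<open>to_ac\<close>
  is injective, so l does too.\<close>

lemma scalar_of_ext_op_scalar:
  assumes Z: "Vector_Spaces.linear sc sc Z" and "B \<noteq> {}"
    and ext: "\<And>u. u \<in> ext_space B \<Longrightarrow> ext Z u = fun_scale l u"
  shows "\<exists>c. Z = sc c"
proof -
  interpret VP: vector_space_pair sc sc ..
  have *: "to_ac (representation B (Z a) b) = (if b = a then l else 0)" if "a \<in> B" for a b
  proof -
    let ?\<delta> = "\<lambda>b. if b = a then 1 else 0 :: 'l alg_closure"
    have \<delta>: "?\<delta> \<in> ext_space B" using that by (auto simp: ext_space_def)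
    have "ext Z ?\<delta> b = (\<Sum>c\<in>B. if c = a then to_ac (representation B (Z a) b) else 0)"
      unfolding ext_op_def by (intro sum.cong) auto
    also have "\<dots> = to_ac (representation B (Z a) b)" using that fin by simp
    finally show ?thesis using fun_cong[OF ext[OF \<delta>], of b] by (cases "b = a") simp_all
  qed
  obtain a where a: "a \<in> B" using \<open>B \<noteq> {}\<close> by blast
  define c where "c = representation B (Z a) a"
  have l: "l = to_ac c" using *[OF a, of a] by (simp add: c_def)
  have "Z b = sc c b" if "b \<in> B" for b
  proof -
    have r: "representation B (Z b) d = (if d = b then c else 0)" for d
      using *[OF that, of d] unfolding l by (auto split: if_splits)
    have "Z b = (\<Sum>d\<in>B. sc (representation B (Z b) d) d)"
      using sum_representation_eq[OF basisD(1) _ fin, of "Z b"] basisD(2) by simp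
    also have "\<dots> = (\<Sum>d\<in>B. if d = b then sc c b else 0)" unfolding r by (intro sum.cong) auto
    finally show ?thesis using that fin by simp
  qed
  moreover have "Vector_Spaces.linear sc sc (sc c)" by (rule linear_scale_self)
  ultimately have "Z x = sc c x" for x
    using VP.linear_eq_on_span[OF Z, of "sc c" B x] basisD(2) by simp
  then show ?thesis by blast
qed

end

lemma irreducible_opsD:
  assumes "irreducible_ops sc U S" "U' \<subseteq> U" "module.subspace sc U'" "\<And>A. A \<in> S \<Longrightarrow> A ` U' \<subseteq> U'"
  shows "U' = {0} \<or> U' = U"
  using assms unfolding irreducible_ops_def by blast

text \<open>The finite order provides an eigenvalue of Z over the closure. The eigenspace is
  invariant because Z commutes with the representation, so by irreducibility it is everything; the
  scalar then descends.\<close>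

lemma schur_finite_order:
  fixes sc :: "'l::field \<Rightarrow> 'v::ab_group_add \<Rightarrow> 'v"
  assumes vs: "vector_space sc" and irr: "abs_irreducible sc G \<rho>"
    and \<rho>: "\<And>x. x \<in> carrier G \<Longrightarrow> Vector_Spaces.linear sc sc (\<rho> x)"
    and Z: "Vector_Spaces.linear sc sc Z" and N: "N > 0" "Z ^^ N = id"
    and comm: "\<And>x. x \<in> carrier G \<Longrightarrow> Z \<circ> \<rho> x = \<rho> x \<circ> Z"
  obtains c where "Z = sc c"
proof -
  let ?s = "\<lambda>c (u :: 'v \<Rightarrow> 'l alg_closure) b. c * u b"
  interpret vector_space sc by fact
  interpret X: vector_space ?s by (rule vector_space_fun)
  obtain B where B: "finite B" "is_basis sc B"
    and ir: "irreducible_ops ?s (ext_space B) ((\<lambda>x. ext_op sc to_ac B (\<rho> x)) ` carrier G)"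
    using irr by (auto simp: abs_irreducible_def)
  let ?U = "ext_space B :: ('v \<Rightarrow> 'l alg_closure) set"
  let ?ext = "ext_op sc (to_ac :: 'l \<Rightarrow> 'l alg_closure) B"
  note closed = ext_op_closed[OF vs B] and comp = ext_op_comp[OF vs B] and sub = subspace_ext_space[OF vs B]
  interpret eZ: Vector_Spaces.linear ?s ?s "?ext Z" by (rule ext_op_linear[OF vs B])
  obtain u where u: "u \<in> ?U" "u \<noteq> 0"
    using ir X.subspace_0[OF sub] by (auto simp: irreducible_ops_def)
  have "(?ext Z ^^ i) u = ?ext (Z ^^ i) u" for i
  proof (induction i)
    case 0 show ?case using ext_op_id[OF vs B u(1)] by (simp flip: id_def)
  next
    case (Suc i) then show ?case using comp[OF Z, of "Z ^^ i" u] by (simp add: o_def)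
  qed
  then have "(?ext Z ^^ N) u = u" using N(2) ext_op_id[OF vs B u(1)] by simp
  moreover have "?ext Z ` ?U \<subseteq> ?U" using closed by (rule image_subsetI)
  ultimately have "\<exists>l w. w \<in> ?U \<and> w \<noteq> 0 \<and> ?ext Z w = ?s l w"
    using eigenvector_of_finite_order[OF ext_op_linear[OF vs B] sub _ u N(1)] by simp
  then obtain l w where w: "w \<in> ?U" "w \<noteq> 0" "?ext Z w = ?s l w" by (elim exE conjE) (rule that)
  let ?E = "{u \<in> ?U. ?ext Z u = ?s l u}"
  have subE: "X.subspace ?E"
  proof (rule X.subspaceI)
    show "0 \<in> ?E" using X.subspace_0[OF sub] by (simp add: eZ.zero fun_eq_iff)
  next
    fix x y assume "x \<in> ?E" "y \<in> ?E"
    then show "x + y \<in> ?E"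
      using X.subspace_add[OF sub, of x y] by (simp add: eZ.add fun_eq_iff distrib_left)
  next
    fix c x assume "x \<in> ?E"
    then have x: "x \<in> ?U" "?ext Z x = ?s l x" by auto
    have "?ext Z (?s c x) = ?s l (?s c x)" unfolding eZ.scale x(2) by (simp add: mult.left_commute)
    then show "?s c x \<in> ?E" using X.subspace_scale[OF sub x(1), of c] by (simp only: mem_Collect_eq simp_thms)
  qed
  have inv: "?ext (\<rho> x) ` ?E \<subseteq> ?E" if x: "x \<in> carrier G" for x
  proof safe
    fix u assume u: "u \<in> ?U" "?ext Z u = ?s l u"
    show "?ext (\<rho> x) u \<in> ?U" by (rule closed)
    have "?ext Z (?ext (\<rho> x) u) = ?ext (\<rho> x) (?ext Z u)"
      using comp[OF Z, of "\<rho> x" u] comp[OF \<rho>[OF x], of Z u] comm[OF x] by simp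
    also have "\<dots> = ?s l (?ext (\<rho> x) u)" unfolding u(2)
      by (rule module_hom.scale[OF Vector_Spaces.linear.axioms(3)[OF ext_op_linear[OF vs B]]])
    finally show "?ext Z (?ext (\<rho> x) u) = ?s l (?ext (\<rho> x) u)" .
  qed
  have "?E = {0} \<or> ?E = ?U"
  proof (rule irreducible_opsD[OF ir _ subE])
    show "?E \<subseteq> ?U" by (rule subsetI) (simp only: mem_Collect_eq)
    show "A ` ?E \<subseteq> ?E" if "A \<in> (\<lambda>x. ?ext (\<rho> x)) ` carrier G" for A
      using that by (rule imageE) (simp only: inv)
  qed
  moreover have "w \<in> ?E" using w by simp
  ultimately have eq: "?E = ?U" using w(2) by (metis singletonD)
  have ext: "?ext Z u = ?s l u" if "u \<in> ?U" for u
  proof -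
    have "u \<in> ?E" unfolding eq by (rule that)
    then show ?thesis by (simp only: mem_Collect_eq)
  qed
  have "B \<noteq> {}" using u by (auto simp: ext_space_def)
  from scalar_of_ext_op_scalar[OF vs B Z this ext] obtain c where "Z = sc c" by (rule exE)
  then show ?thesis by (rule that)
qed

text \<open>Scalars preserve every line, so irreducibility over the closure makes the line through
  one unit vector the whole space. The basis therefore has a single element.\<close>

lemma dim_scalar_representation:
  fixes sc :: "'l::field \<Rightarrow> 'v::ab_group_add \<Rightarrow> 'v"
  assumes vs: "vector_space sc" and irr: "abs_irreducible sc G \<rho>"
    and scalar: "\<And>x. x \<in> carrier G \<Longrightarrow> \<exists>c. \<rho> x = sc c"
  shows "vector_space.dim sc UNIV = 1"
proof -
  let ?s = "\<lambda>c (u :: 'v \<Rightarrow> 'l alg_closure) b. c * u b"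
  interpret vector_space sc by fact
  interpret X: vector_space ?s by (rule vector_space_fun)
  obtain B where B: "finite B" "is_basis sc B"
    and ir: "irreducible_ops ?s (ext_space B) ((\<lambda>x. ext_op sc to_ac B (\<rho> x)) ` carrier G)"
    using irr by (auto simp: abs_irreducible_def)
  have "ext_space B \<noteq> {0 :: 'v \<Rightarrow> 'l alg_closure}" using ir by (simp add: irreducible_ops_def)
  moreover have "ext_space {} = {0 :: 'v \<Rightarrow> 'l alg_closure}" by (auto simp: ext_space_def)
  ultimately obtain a where a: "a \<in> B" by fastforce
  let ?\<delta> = "\<lambda>a b. if b = a then 1 else 0 :: 'l alg_closure"
  define L where "L = range (\<lambda>c. ?s c (?\<delta> a))"
  have subL: "X.subspace L"
    unfolding X.subspace_def
  proof (intro conjI allI ballI)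
    show "0 \<in> L" unfolding L_def by (rule range_eqI[of _ _ 0]) auto
    show "x + y \<in> L" if "x \<in> L" "y \<in> L" for x y
    proof -
      obtain c d where "x = ?s c (?\<delta> a)" "y = ?s d (?\<delta> a)" using \<open>x \<in> L\<close> \<open>y \<in> L\<close> unfolding L_def by blast
      then show ?thesis unfolding L_def by (intro range_eqI[of _ _ "c + d"]) auto
    qed
    show "?s k x \<in> L" if "x \<in> L" for k x
    proof -
      obtain c where "x = ?s c (?\<delta> a)" using \<open>x \<in> L\<close> unfolding L_def by blast
      then show ?thesis unfolding L_def by (intro range_eqI[of _ _ "k * c"]) auto
    qed
  qed
  have sub: "L \<subseteq> ext_space B" using a by (auto simp: ext_space_def L_def)
  have inv: "ext_op sc to_ac B (\<rho> x) ` L \<subseteq> L" if "x \<in> carrier G" for x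
  proof -
    obtain c where "\<rho> x = sc c" using scalar \<open>x \<in> carrier G\<close> by blast
    have eq: "ext_op sc to_ac B (\<rho> x) u = ?s (to_ac c) u" if "u \<in> L" for u
      unfolding \<open>\<rho> x = sc c\<close> by (rule ext_op_scale[OF vs B subsetD[OF sub that]])
    show ?thesis
    proof (rule image_subsetI)
      fix u assume u: "u \<in> L"
      show "ext_op sc to_ac B (\<rho> x) u \<in> L"
        unfolding eq[OF u] by (rule X.subspace_scale[OF \<open>X.subspace L\<close> u])
    qed
  qed
  have "L = {0} \<or> L = ext_space B"
  proof (rule irreducible_opsD[OF ir sub subL])
    show "A ` L \<subseteq> L" if "A \<in> (\<lambda>x. ext_op sc to_ac B (\<rho> x)) ` carrier G" for A
      using that by (rule imageE) (simp only: inv)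
  qed
  moreover have "?\<delta> a \<in> L" unfolding L_def by (rule range_eqI[of _ _ 1]) simp
  moreover have "?\<delta> a \<noteq> 0" by (auto simp: fun_eq_iff)
  ultimately have Leq: "L = ext_space B" by blast
  have "b = a" if "b \<in> B" for b
  proof -
    have "?\<delta> b \<in> L" unfolding Leq using that by (auto simp: ext_space_def)
    then obtain c where "?\<delta> b = ?s c (?\<delta> a)" unfolding L_def by blast
    from fun_cong[OF this, of b] show ?thesis by (auto split: if_splits)
  qed
  then have "B = {a}" using a by blast
  then show ?thesis using dim_eq_card[of B UNIV] B(2) by (simp add: is_basis_def)
qed

section \<open>The isometry group\<close>

text \<open>Reindexing along t multiplies the sum by c, which differs from 1. This is character
  orthogonality in abstract form, with F a character and t a translation.\<close>

lemma sum_character_zero: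
  fixes F :: "'a \<Rightarrow> 'l::field"
  assumes "bij_betw t A A" "\<And>b. b \<in> A \<Longrightarrow> F (t b) = c * F b" "c \<noteq> 1"
  shows "sum F A = 0"
proof -
  have "sum F A = (\<Sum>b\<in>A. F (t b))" by (rule sum.reindex_bij_betw[OF assms(1), symmetric])
  also have "\<dots> = c * sum F A" by (simp add: assms(2) sum_distrib_left)
  finally show ?thesis using assms(3) by (simp add: algebra_simps)
qed

text \<open>All nonempty fibres of an additive map are translates of its kernel.\<close>

lemma card_eq_card_kernel_range:
  fixes h :: "'w::ab_group_add \<Rightarrow> 'v::ab_group_add"
  assumes "finite (UNIV :: 'w set)" "\<And>x y. h (x + y) = h x + h y"
  shows "h x0 = y \<Longrightarrow> card {x. h x = y} = card {x. h x = 0}"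
    and "CARD('w) = card {x. h x = 0} * card (range h)"
proof -
  have diff: "h (x - z) = h x - h z" for x z using assms(2)[of "x - z" z] by (simp add: algebra_simps)
  have *: "card {x. h x = y} = card {x. h x = 0}" if "h x0 = y" for x0 y
    by (rule bij_betw_same_card[symmetric], rule bij_betwI[of "\<lambda>x. x + x0" _ _ "\<lambda>x. x - x0"])
      (use that in \<open>auto simp: assms(2) diff\<close>)
  then show "h x0 = y \<Longrightarrow> card {x. h x = y} = card {x. h x = 0}" .
  have "CARD('w) = (\<Sum>y\<in>range h. card {x. h x = y})"
    using sum.image_gen[OF assms(1), of "\<lambda>_. 1 :: nat" h] by simp
  also have "\<dots> = (\<Sum>y\<in>range h. card {x. h x = 0})" by (intro sum.cong) (auto intro: *)
  finally show "CARD('w) = card {x. h x = 0} * card (range h)" by (simp add: mult.commute)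
qed

lemma dual_space_iff:
  assumes "vector_space sW"
  shows "\<alpha> \<in> dual_space sW \<longleftrightarrow> (\<forall>x y. \<alpha> (x + y) = \<alpha> x + \<alpha> y) \<and> (\<forall>c x. \<alpha> (sW c x) = c * \<alpha> x)"
proof -
  have "vector_space ((*) :: 'a \<Rightarrow> 'a \<Rightarrow> 'a)" by unfold_locales (simp_all add: algebra_simps)
  then show ?thesis using assms by (simp add: dual_space_def Vector_Spaces.linear_iff)
qed

lemma vector_space_dbl_scale:
  assumes "vector_space sW"
  shows "vector_space (dbl_scale sW)"
proof -
  interpret vector_space sW by fact
  show ?thesis
    by unfold_locales (auto simp: dbl_scale_def scale_right_distrib scale_left_distrib algebra_simps fun_eq_iff prod_eq_iff)
qed

lemma isometry_groupD:
  assumes "g \<in> carrier (isometry_group sW f)"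
  shows "g \<in> extensional (dbl_space sW)" "bij_betw g (dbl_space sW) (dbl_space sW)"
    and "\<And>x y. x \<in> dbl_space sW \<Longrightarrow> y \<in> dbl_space sW \<Longrightarrow> g (x + y) = g x + g y"
    and "\<And>c x. x \<in> dbl_space sW \<Longrightarrow> g (dbl_scale sW c x) = dbl_scale sW c (g x)"
    and "\<And>x y. x \<in> dbl_space sW \<Longrightarrow> y \<in> dbl_space sW \<Longrightarrow> f (g x) (g y) = f x y"
  using assms by (auto simp: isometry_group_def Let_def)

lemma isometry_group_mult:
  "g \<otimes>\<^bsub>isometry_group sW f\<^esub> h = compose (dbl_space sW) h g"
  by (simp add: isometry_group_def Let_def)

lemma isometry_group_one: "\<one>\<^bsub>isometry_group sW f\<^esub> = (\<lambda>x\<in>dbl_space sW. x)"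
  by (simp add: isometry_group_def Let_def)

context
  fixes sW :: "'k::field \<Rightarrow> 'w::ab_group_add \<Rightarrow> 'w"
  assumes vsW: "vector_space sW"
begin

interpretation W: vector_space sW by (fact vsW)

lemma dbl_space_closed:
  "u \<in> dbl_space sW \<Longrightarrow> v \<in> dbl_space sW \<Longrightarrow> u + v \<in> dbl_space sW"
  "u \<in> dbl_space sW \<Longrightarrow> v \<in> dbl_space sW \<Longrightarrow> u - v \<in> dbl_space sW"
  "u \<in> dbl_space sW \<Longrightarrow> dbl_scale sW c u \<in> dbl_space sW"
  "0 \<in> dbl_space sW"
  by (auto simp: dbl_space_def dual_space_iff[OF vsW] dbl_scale_def zero_prod_def algebra_simps)

lemma isometry_groupI:
  assumes "g \<in> extensional (dbl_space sW)" "bij_betw g (dbl_space sW) (dbl_space sW)"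
    and "\<And>x y. x \<in> dbl_space sW \<Longrightarrow> y \<in> dbl_space sW \<Longrightarrow> g (x + y) = g x + g y"
    and "\<And>c x. x \<in> dbl_space sW \<Longrightarrow> g (dbl_scale sW c x) = dbl_scale sW c (g x)"
    and "\<And>x y. x \<in> dbl_space sW \<Longrightarrow> y \<in> dbl_space sW \<Longrightarrow> f (g x) (g y) = f x y"
  shows "g \<in> carrier (isometry_group sW f)"
  using assms by (auto simp: isometry_group_def Let_def)

lemma isometry_group_mult_closed:
  assumes g: "g \<in> carrier (isometry_group sW f)" and h: "h \<in> carrier (isometry_group sW f)"
  shows "compose (dbl_space sW) h g \<in> carrier (isometry_group sW f)"
proof (rule isometry_groupI)
  note * = isometry_groupD[OF g] isometry_groupD[OF h]
  have mem: "g x \<in> dbl_space sW" if "x \<in> dbl_space sW" for x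
    using *(2) that by (auto simp: bij_betw_def)
  show "compose (dbl_space sW) h g \<in> extensional (dbl_space sW)" by (rule compose_extensional)
  show "bij_betw (compose (dbl_space sW) h g) (dbl_space sW) (dbl_space sW)"
    by (rule bij_betw_compose[OF *(2) *(7)])
qed (use isometry_groupD[OF g] isometry_groupD[OF h] in
     \<open>auto simp: compose_eq dbl_space_closed bij_betw_apply\<close>)

lemma monoid_isometry_group: "monoid (isometry_group sW f)"
proof
  fix g h k assume g: "g \<in> carrier (isometry_group sW f)" and h: "h \<in> carrier (isometry_group sW f)"
    and "k \<in> carrier (isometry_group sW f)"
  show "g \<otimes>\<^bsub>isometry_group sW f\<^esub> h \<in> carrier (isometry_group sW f)"
    using isometry_group_mult_closed[OF g h] by (simp add: isometry_group_mult)
  have "g \<in> dbl_space sW \<rightarrow> dbl_space sW" using isometry_groupD(2)[OF g] by (auto simp: bij_betw_def)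
  then show "g \<otimes>\<^bsub>isometry_group sW f\<^esub> h \<otimes>\<^bsub>isometry_group sW f\<^esub> k =
      g \<otimes>\<^bsub>isometry_group sW f\<^esub> (h \<otimes>\<^bsub>isometry_group sW f\<^esub> k)"
    by (auto simp: isometry_group_mult compose_def fun_eq_iff)
next
  show "\<one>\<^bsub>isometry_group sW f\<^esub> \<in> carrier (isometry_group sW f)"
    unfolding isometry_group_one
    by (rule isometry_groupI) (auto simp: dbl_space_closed bij_betw_def inj_on_def)
next
  fix g assume g: "g \<in> carrier (isometry_group sW f)"
  have "g x \<in> dbl_space sW" if "x \<in> dbl_space sW" for x
    using isometry_groupD(2)[OF g] that by (auto simp: bij_betw_def)
  then show "\<one>\<^bsub>isometry_group sW f\<^esub> \<otimes>\<^bsub>isometry_group sW f\<^esub> g = g"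
      "g \<otimes>\<^bsub>isometry_group sW f\<^esub> \<one>\<^bsub>isometry_group sW f\<^esub> = g"
    using isometry_groupD(1)[OF g]
    by (auto simp: isometry_group_one isometry_group_mult compose_def fun_eq_iff extensional_def)
qed

text \<open>The monoid laws determine two-sided inverses, so it is enough to exhibit one in the
  carrier; \<open>restrict\<close> makes the inverse map extensional.\<close>

lemma isometry_group_inv:
  assumes g: "g \<in> carrier (isometry_group sW f)"
  shows "inv\<^bsub>isometry_group sW f\<^esub> g = restrict (inv_into (dbl_space sW) g) (dbl_space sW)"
proof -
  let ?V = "dbl_space sW" and ?h = "restrict (inv_into (dbl_space sW) g) (dbl_space sW)"
  note gD = isometry_groupD[OF g]
  have inj: "inj_on g ?V" and surj: "g ` ?V = ?V" using gD(2) by (auto simp: bij_betw_def)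
  have gh: "g (?h v) = v" and hV: "?h v \<in> ?V" if "v \<in> ?V" for v
    using that surj f_inv_into_f[of v g ?V] inv_into_into[of v g ?V] by auto
  have hg: "?h (g v) = v" if "v \<in> ?V" for v
    using that surj inv_into_f_f[OF inj] by (metis imageI restrict_apply')
  have h: "?h \<in> carrier (isometry_group sW f)"
  proof (rule isometry_groupI)
    show "bij_betw ?h ?V ?V" by (rule bij_betw_byWitness[of _ g]) (use gh hg hV surj in auto)
    show "?h (x + y) = ?h x + ?h y" if "x \<in> ?V" "y \<in> ?V" for x y
      using hg[of "?h x + ?h y"] hV[OF that(1)] hV[OF that(2)] gh that gD(3) dbl_space_closed(1) by metis
    show "?h (dbl_scale sW c x) = dbl_scale sW c (?h x)" if "x \<in> ?V" for c x
      using hg[of "dbl_scale sW c (?h x)"] hV[OF that] gh that gD(4) dbl_space_closed(3) by metis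
    show "f (?h x) (?h y) = f x y" if "x \<in> ?V" "y \<in> ?V" for x y
      using gD(5)[OF hV[OF that(1)] hV[OF that(2)]] gh that by metis
  qed auto
  have "g \<otimes>\<^bsub>isometry_group sW f\<^esub> ?h = \<one>\<^bsub>isometry_group sW f\<^esub>"
    "?h \<otimes>\<^bsub>isometry_group sW f\<^esub> g = \<one>\<^bsub>isometry_group sW f\<^esub>"
    unfolding isometry_group_mult isometry_group_one compose_def using gh hg
    by (auto intro!: restrict_ext)
  with monoid.inv_unique'[OF monoid_isometry_group g h] show ?thesis by simp
qed

text \<open>Writing an element of V as g v, its image under 1 minus the inverse of g is g v - v =
  (-v) - g (-v), and negation permutes V. This gives equal values of \<open>j_dim\<close> at g and
  at its inverse.\<close>

lemma I_img_inv:
  assumes g: "g \<in> carrier (isometry_group sW f)"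
  shows "I_img sW (inv\<^bsub>isometry_group sW f\<^esub> g) = I_img sW g"
proof -
  let ?V = "dbl_space sW"
  note gD = isometry_groupD[OF g]
  have inj: "inj_on g ?V" and surj: "g ` ?V = ?V" using gD(2) by (auto simp: bij_betw_def)
  have neg: "-v \<in> ?V" "g (-v) = - g v" if "v \<in> ?V" for v
  proof -
    show "-v \<in> ?V" using dbl_space_closed(2)[OF dbl_space_closed(4) that] by simp
    then have "g v + g (-v) = g 0" "g (0 + 0) = g 0 + g 0" 
      using gD(3)[OF that, of "-v"] gD(3)[OF dbl_space_closed(4) dbl_space_closed(4)] by simp_all
    then show "g (-v) = - g v" by (simp add: add_eq_0_iff)
  qed
  have "I_img sW (inv\<^bsub>isometry_group sW f\<^esub> g) = (\<lambda>v. v - inv_into ?V g v) ` (g ` ?V)"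
    unfolding I_img_def isometry_group_inv[OF g] surj by auto
  also have "\<dots> = (\<lambda>v. (-v) - g (-v)) ` ?V"
    unfolding image_image by (intro image_cong refl) (simp add: inv_into_f_f[OF inj] neg)
  also have "\<dots> = (\<lambda>v. v - g v) ` (uminus ` ?V)" by (simp add: image_image)
  also have "uminus ` ?V = ?V"
  proof (intro equalityI subsetI)
    show "v \<in> uminus ` ?V" if "v \<in> ?V" for v using neg(1)[OF that] by (intro image_eqI[of _ _ "-v"]) simp_all
  qed (use neg(1) in auto)
  finally show ?thesis by (simp add: I_img_def)
qed

end

section \<open>Nondegeneracy of the pairing and the block form of isometries\<close>

locale finite_dual_pair =
  fixes sW :: "'k::finite_field \<Rightarrow> 'w::ab_group_add \<Rightarrow> 'w" and T :: "'k \<Rightarrow> 'p::prime_card mod_ring"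
    and f :: "('k, 'w) dbl \<Rightarrow> ('k, 'w) dbl \<Rightarrow> 'p mod_ring"
  assumes vsW: "vector_space sW" and finW: "finite (UNIV :: 'w set)"
    and char: "CHAR('k) = CARD('p)" and T_def: "T = abs_trace" and f_def: "f = trace_form"
begin

sublocale W: vector_space sW by (fact vsW)

abbreviation "D \<equiv> dual_space sW"
abbreviation "G \<equiv> isometry_group sW f"

lemma T_add: "T (a + b) = T a + T b"
  unfolding T_def by (rule abs_trace_add[OF char])

lemma T_0 [simp]: "T 0 = 0" using T_add[of 0 0] by (simp only: add_0_left add_cancel_right_right)
lemma T_minus: "T (- a) = - T a" using T_add[of a "- a"] by (simp add: add_eq_0_iff)
lemma T_diff: "T (a - b) = T a - T b" using T_add[of a "- b"] by (simp add: T_minus)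

lemma T_eq_1: obtains e where "T e = 1"
  using abs_trace_eq_1[OF char] unfolding T_def by blast

lemma form_eq: "f u v = T (fst v (snd u))"
  by (simp add: f_def trace_form_def T_def)

lemma dualD:
  assumes "\<beta> \<in> D"
  shows "\<beta> (x + y) = \<beta> x + \<beta> y" "\<beta> (sW c x) = c * \<beta> x" "\<beta> 0 = 0" "\<beta> (- x) = - \<beta> x"
    "\<beta> (x - y) = \<beta> x - \<beta> y"
proof -
  show add: "\<beta> (x + y) = \<beta> x + \<beta> y" for x y using assms by (simp add: dual_space_iff[OF vsW])
  show "\<beta> (sW c x) = c * \<beta> x" using assms by (simp add: dual_space_iff[OF vsW])
  show "\<beta> 0 = 0" using add[of 0 0] by (simp only: add_0_left add_cancel_right_right)
  then show neg: "\<beta> (- x) = - \<beta> x" for x using add[of x "-x"] by (simp add: add_eq_0_iff)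
  show "\<beta> (x - y) = \<beta> x - \<beta> y" using add[of x "-y"] neg by simp
qed

lemma dual_closed:
  "0 \<in> D" "\<beta> \<in> D \<Longrightarrow> \<gamma> \<in> D \<Longrightarrow> \<beta> + \<gamma> \<in> D" "\<beta> \<in> D \<Longrightarrow> - \<beta> \<in> D" 
  "\<beta> \<in> D \<Longrightarrow> \<gamma> \<in> D \<Longrightarrow> \<beta> - \<gamma> \<in> D" "\<beta> \<in> D \<Longrightarrow> (\<lambda>x. c * \<beta> x) \<in> D"
  by (auto simp: dual_space_iff[OF vsW] algebra_simps)

lemma finite_dual: "finite D"
proof -
  have "finite (PiE (UNIV :: 'w set) (\<lambda>_. UNIV :: 'k set))" by (intro finite_PiE finW) auto
  then show ?thesis by (rule rev_finite_subset) auto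
qed

text \<open>Extend {x} to a basis and prescribe at x a value of trace 1. This is one half of the
  nondegeneracy of the pairing T(x \<beta>).\<close>

lemma dual_separates:
  assumes "x \<noteq> 0"
  obtains \<beta> where "\<beta> \<in> D" "T (\<beta> x) = 1"
proof -
  obtain e where e: "T e = 1" by (rule T_eq_1)
  have "vector_space ((*) :: 'k \<Rightarrow> 'k \<Rightarrow> 'k)" by unfold_locales (simp_all add: algebra_simps)
  then interpret VP: vector_space_pair sW "(*) :: 'k \<Rightarrow> 'k \<Rightarrow> 'k" 
    by (intro vector_space_pair.intro vsW)
  have "W.independent {x}" using assms by simp
  from VP.linear_independent_extend[OF this, of "\<lambda>_. e"]
  obtain \<beta> where "Vector_Spaces.linear sW (*) \<beta>" "\<beta> x = e" by auto
  then show ?thesis using that[of \<beta>] e by (simp add: dual_space_def)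
qed

text \<open>The other half: a vector where \<beta> is nonzero is rescaled until the value has trace
  1.\<close>

lemma dual_nonzero:
  assumes "\<beta> \<in> D" "\<beta> \<noteq> 0"
  obtains x where "T (\<beta> x) = 1"
proof -
  obtain e where e: "T e = 1" by (rule T_eq_1)
  obtain x where "\<beta> x \<noteq> 0" using assms(2) by (auto simp: fun_eq_iff)
  then show ?thesis using that[of "sW (e / \<beta> x) x"] dualD(2)[OF assms(1)] e by simp
qed

text \<open>The two diagonal blocks of g; \<open>isometry_split\<close> shows that the off-diagonal
  blocks vanish.\<close>

definition wpart :: "(('k, 'w) dbl \<Rightarrow> ('k, 'w) dbl) \<Rightarrow> 'w \<Rightarrow> 'w" where
  "wpart g x = snd (g (0, x))"

definition dpart :: "(('k, 'w) dbl \<Rightarrow> ('k, 'w) dbl) \<Rightarrow> ('w \<Rightarrow> 'k) \<Rightarrow> ('w \<Rightarrow> 'k)" where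
  "dpart g \<beta> = fst (g (\<beta>, 0))"

text \<open>
  \<open>W\<close> and \<open>W\<^sup>*\<close> are the right and left radicals of \<open>f\<close>, so an isometry preserves both.
\<close>

lemma isometry_split:
  assumes g: "g \<in> carrier G"
  shows "\<beta> \<in> D \<Longrightarrow> g (\<beta>, x) = (dpart g \<beta>, wpart g x)"
    and "\<beta> \<in> D \<Longrightarrow> dpart g \<beta> \<in> D"
    and "\<beta> \<in> D \<Longrightarrow> T (dpart g \<beta> (wpart g x)) = T (\<beta> x)"
    and "wpart g (x + y) = wpart g x + wpart g y"
    and "wpart g (sW c x) = sW c (wpart g x)"
    and "bij (wpart g)"
    and "dpart g 0 = 0"
proof -
  note gD = isometry_groupD[OF g]
  have V: "v \<in> dbl_space sW \<longleftrightarrow> fst v \<in> D" for v :: "('k, 'w) dbl" by (cases v) (simp add: dbl_space_def)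
  have gV: "fst (g v) \<in> D" if "fst v \<in> D" for v using bij_betw_apply[OF gD(2)] that by (simp add: V)
  have surj: "\<exists>v. fst v \<in> D \<and> g v = w" if "fst w \<in> D" for w
  proof -
    have "w \<in> g ` dbl_space sW" using bij_betw_imp_surj_on[OF gD(2)] V[of w] that by simp
    then show ?thesis using V by (auto elim!: imageE)
  qed
  have form: "T (fst (g v) (snd (g u))) = T (fst v (snd u))" if "fst u \<in> D" "fst v \<in> D" for u v
    using gD(5)[of u v] that by (simp add: V form_eq)
  \<comment> \<open>The form vanishes when its second argument lies in W. Since g is onto, (0, y)
    has a preimage, and invariance of the form carries this vanishing over to g (0, x).\<close>
  have W: "fst (g (0, x)) = 0" for x
  proof (rule ccontr)
    assume "fst (g (0, x)) \<noteq> 0"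
    then obtain y where y: "T (fst (g (0, x)) y) = 1"
      using dual_nonzero gV[of "(0, x)"] dual_closed(1) by (metis fst_conv)
    obtain u where "fst u \<in> D" "g u = (0, y)" using surj[of "(0, y)"] dual_closed(1) by auto
    then show False using form[of u "(0, x)"] y dual_closed(1) by simp
  qed
  have W': "snd (g (\<beta>, 0)) = 0" if "\<beta> \<in> D" for \<beta>
  proof (rule ccontr)
    assume "snd (g (\<beta>, 0)) \<noteq> 0"
    then obtain \<gamma> where \<gamma>: "\<gamma> \<in> D" "T (\<gamma> (snd (g (\<beta>, 0)))) = 1" by (rule dual_separates)
    obtain v where v: "fst v \<in> D" "g v = (\<gamma>, 0)" using surj[of "(\<gamma>, 0)"] \<gamma>(1) by auto
    then show False using form[of "(\<beta>, 0)" v] \<gamma> that dualD(3)[OF v(1)] by simp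
  qed
  have g0: "g (0, x) = (0, wpart g x)" for x using W by (simp add: wpart_def prod_eq_iff)
  have gd: "g (\<beta>, 0) = (dpart g \<beta>, 0)" if "\<beta> \<in> D" for \<beta> using W' that by (simp add: dpart_def prod_eq_iff)
  show split: "g (\<beta>, x) = (dpart g \<beta>, wpart g x)" if "\<beta> \<in> D" for \<beta> x
    using gD(3)[of "(\<beta>, 0)" "(0, x)"] that dual_closed(1) by (simp add: V g0 gd)
  show "\<beta> \<in> D \<Longrightarrow> dpart g \<beta> \<in> D" using gV[of "(\<beta>, 0)"] by (simp add: dpart_def)
  show "\<beta> \<in> D \<Longrightarrow> T (dpart g \<beta> (wpart g x)) = T (\<beta> x)"
    using form[of "(0, x)" "(\<beta>, 0)"] dual_closed(1) by (simp add: g0 gd)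
  show add: "wpart g (x + y) = wpart g x + wpart g y" for x y
    using gD(3)[of "(0, x)" "(0, y)"] dual_closed(1) by (simp add: V g0)
  show "wpart g (sW c x) = sW c (wpart g x)"
    using gD(4)[of "(0, x)" c] dual_closed(1) by (simp add: V g0 dbl_scale_def zero_fun_def[symmetric])
  show "dpart g 0 = 0" using W[of 0] by (simp add: dpart_def)
  have "x = y" if "wpart g x = wpart g y" for x y
  proof -
    have "g (0, x) = g (0, y)" unfolding g0 that ..
    then have "(0 :: 'w \<Rightarrow> 'k, x) = (0, y)"
      by (rule inj_onD[OF bij_betw_imp_inj_on[OF gD(2)]]) (simp_all add: V dual_closed(1))
    then show ?thesis by simp
  qed
  moreover have "\<exists>x. wpart g x = y" for y
  proof -
    obtain v where "fst v \<in> D" "g v = (0, y)" using surj[of "(0, y)"] dual_closed(1) by auto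
    then show ?thesis using split[of "fst v" "snd v"] by auto
  qed
  ultimately show "bij (wpart g)" by (metis bijI injI surjI)
qed

lemma wpart_compose:
  assumes "g \<in> carrier G" "h \<in> carrier G"
  shows "wpart (g \<otimes>\<^bsub>G\<^esub> h) x = wpart h (wpart g x)"
  using isometry_split(1)[OF assms(1) dual_closed(1), of x] isometry_split(7)[OF assms(1)]
  by (simp add: isometry_group_mult wpart_def compose_eq dbl_space_def dual_closed)

lemma wpart_0: "g \<in> carrier G \<Longrightarrow> wpart g 0 = 0"
  using isometry_split(4)[of g 0 0] by simp

lemma wpart_diff: "g \<in> carrier G \<Longrightarrow> wpart g (x - y) = wpart g x - wpart g y"
  using isometry_split(4)[of g "x - y" y] by (simp only: diff_add_cancel eq_diff_eq)

text \<open>By the block form, I(g) meets W exactly in the image of 1 - a, where a is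
  \<open>wpart g\<close>; that image is a K-subspace with |K| to the power j(g) elements. Kernel
  times image gives |W|.\<close>

lemma CARD_eq_fixed_j_dim:
  assumes g: "g \<in> carrier G"
  shows "CARD('w) = card {x. x - wpart g x = 0} * CARD('k) ^ j_dim sW g"
proof -
  note s = isometry_split[OF g]
  interpret V: vector_space "dbl_scale sW" by (rule vector_space_dbl_scale[OF vsW])
  let ?r = "range (\<lambda>x. x - wpart g x)"
  let ?S = "Pair (0 :: 'w \<Rightarrow> 'k) ` ?r"
  have I: "I_img sW g \<inter> W_in_dbl = ?S"
  proof (intro equalityI subsetI)
    fix v assume "v \<in> I_img sW g \<inter> W_in_dbl"
    then have "v \<in> I_img sW g" and v: "fst v = 0" by (simp_all add: W_in_dbl_def mem_Times_iff)
    then obtain u where u: "u \<in> dbl_space sW" "v = u - g u" unfolding I_img_def by (elim imageE)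
    obtain \<beta> x where "u = (\<beta>, x)" by fastforce
    with u v have "\<beta> \<in> D" "v = (\<beta>, x) - g (\<beta>, x)" "fst v = 0" by (simp_all add: dbl_space_def)
    then show "v \<in> ?S" using s(1)[of \<beta> x] by (auto simp: prod_eq_iff)
  next
    fix v :: "('k, 'w) dbl" assume "v \<in> ?S"
    then obtain x where "v = (0, x - wpart g x)" by auto
    then have "v = (0, x) - g (0, x)" using s(1)[of 0 x] s(7) dual_closed(1) by simp
    then have "v \<in> I_img sW g"
      unfolding I_img_def by (rule image_eqI) (simp add: dbl_space_def dual_closed(1))
    with \<open>v = (0, x - wpart g x)\<close> show "v \<in> I_img sW g \<inter> W_in_dbl" by (simp add: W_in_dbl_def)
  qed
  have "V.subspace ?S"
  proof (rule V.subspaceI)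
    show "0 \<in> ?S" using wpart_0[OF g]
      by (auto simp: zero_prod_def image_iff intro!: exI[of _ 0])
  next
    fix u v assume "u \<in> ?S" "v \<in> ?S"
    then obtain x y where "u = (0, x - wpart g x)" "v = (0, y - wpart g y)" by auto
    then have "u + v = (0, (x + y) - wpart g (x + y))" by (simp add: s(4))
    then show "u + v \<in> ?S" by auto
  next
    fix c v assume "v \<in> ?S"
    then obtain x where "v = (0, x - wpart g x)" by auto
    then have "dbl_scale sW c v = (0, sW c x - wpart g (sW c x))"
      by (simp add: s(5) dbl_scale_def W.scale_right_diff_distrib zero_fun_def)
    then show "dbl_scale sW c v \<in> ?S" by auto
  qed
  moreover have "finite ?r" using finite_imageI[OF finW] .
  ultimately have "card (?S) = CARD('k) ^ j_dim sW g"
    unfolding j_dim_def I by (intro card_subspace vector_space_dbl_scale vsW) auto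
  moreover have "card (?S) = card ?r" by (rule card_image) (auto simp: inj_on_def)
  ultimately show ?thesis
    using card_eq_card_kernel_range(2)[OF finW, of "\<lambda>x. x - wpart g x"] by (simp add: s(4) algebra_simps)
qed

end

section \<open>The representation\<close>

lemma monoid_GL:
  assumes "vector_space sc"
  shows "monoid (GL sc)"
  using assms by unfold_locales (auto simp: GL_def Vector_Spaces.linear_iff intro: bij_comp)

lemma GL_mult: "A \<otimes>\<^bsub>GL sc\<^esub> B = B \<circ> A"
  by (simp add: GL_def)

locale extraspecial_representation = finite_dual_pair sW T f
  for sW :: "'k::finite_field \<Rightarrow> 'w::ab_group_add \<Rightarrow> 'w" and T :: "'k \<Rightarrow> 'p::prime_card mod_ring"
    and f :: "('k, 'w) dbl \<Rightarrow> ('k, 'w) dbl \<Rightarrow> 'p mod_ring" +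
  fixes sV :: "'l::field \<Rightarrow> 'v::ab_group_add \<Rightarrow> 'v"
    and \<rho> :: "('k, 'w) dbl \<times> 'p mod_ring \<Rightarrow> 'v \<Rightarrow> 'v"
  assumes vsV: "vector_space sV" and hom: "\<rho> \<in> hom (extraspecial sW f) (GL sV)"
begin

sublocale V: vector_space sV by (fact vsV)

lemma \<rho>_closed:
  assumes "\<beta> \<in> D"
  shows "\<rho> ((\<beta>, x), c) \<in> carrier (GL sV)"
  using hom assms by (auto simp: hom_def extraspecial_def dbl_space_def)

lemma \<rho>_linear:
  assumes "\<beta> \<in> D"
  shows "\<rho> ((\<beta>, x), c) (v + w) = \<rho> ((\<beta>, x), c) v + \<rho> ((\<beta>, x), c) w"
    "\<rho> ((\<beta>, x), c) (sV a v) = sV a (\<rho> ((\<beta>, x), c) v)"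
    "\<rho> ((\<beta>, x), c) 0 = 0"
    "\<rho> ((\<beta>, x), c) (sum h I) = (\<Sum>i\<in>I. \<rho> ((\<beta>, x), c) (h i))"
    "bij (\<rho> ((\<beta>, x), c))"
proof -
  have lin: "Vector_Spaces.linear sV sV (\<rho> ((\<beta>, x), c))" "bij (\<rho> ((\<beta>, x), c))"
    using \<rho>_closed[OF assms, of x c] by (auto simp: GL_def)
  then show "bij (\<rho> ((\<beta>, x), c))" by simp
  interpret L: Vector_Spaces.linear sV sV "\<rho> ((\<beta>, x), c)" by (fact lin)
  show "\<rho> ((\<beta>, x), c) (v + w) = \<rho> ((\<beta>, x), c) v + \<rho> ((\<beta>, x), c) w"
    "\<rho> ((\<beta>, x), c) (sV a v) = sV a (\<rho> ((\<beta>, x), c) v)"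
    "\<rho> ((\<beta>, x), c) 0 = 0"
    "\<rho> ((\<beta>, x), c) (sum h I) = (\<Sum>i\<in>I. \<rho> ((\<beta>, x), c) (h i))"
    by (rule L.add L.scale L.zero L.sum)+
qed

text \<open>Maps act on the right, so the operator applied first is the left factor in E(f); this is
  why the cocycle pairs x with \<gamma>.\<close>

lemma \<rho>_mult:
  assumes "\<beta> \<in> D" "\<gamma> \<in> D"
  shows "\<rho> ((\<gamma>, y), b) (\<rho> ((\<beta>, x), a) v) = \<rho> ((\<beta> + \<gamma>, x + y), a + b + T (\<gamma> x)) v"
proof -
  have "\<rho> (((\<beta>, x), a) \<otimes>\<^bsub>extraspecial sW f\<^esub> ((\<gamma>, y), b)) = \<rho> ((\<beta>, x), a) \<otimes>\<^bsub>GL sV\<^esub> \<rho> ((\<gamma>, y), b)"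
    using assms by (intro hom_mult[OF hom]) (auto simp: extraspecial_def dbl_space_def)
  then show ?thesis by (simp add: extraspecial_def GL_def form_eq fun_eq_iff[of "\<rho> _" "_ \<circ> _"])
qed

lemma carrier_extraspecial: "z \<in> carrier (extraspecial sW f) \<longleftrightarrow> (\<exists>\<beta> x c. \<beta> \<in> D \<and> z = ((\<beta>, x), c))"
  by (cases z) (auto simp: extraspecial_def dbl_space_def)

text \<open>An injective idempotent map is the identity.\<close>

lemma \<rho>_0: "\<rho> ((0, 0), 0) v = v"
proof (rule injD[OF bij_is_inj[OF \<rho>_linear(5)[OF dual_closed(1)]]])
  show "\<rho> ((0, 0), 0) (\<rho> ((0, 0), 0) v) = \<rho> ((0, 0), 0) v"
    using \<rho>_mult[OF dual_closed(1) dual_closed(1), of 0 0 0 0 v] by simp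
qed

lemma \<rho>_center_power: "(\<rho> ((0, 0), c) ^^ i) v = \<rho> ((0, 0), of_nat i * c) v"
proof (induction i)
  case (Suc i)
  have "\<rho> ((0, 0), c) (\<rho> ((0, 0), of_nat i * c) v) = \<rho> ((0, 0), of_nat (Suc i) * c) v"
    using \<rho>_mult[OF dual_closed(1) dual_closed(1), of 0 c 0 "of_nat i * c" v]
    by (simp add: distrib_right add.commute)
  then show ?case unfolding funpow.simps o_apply Suc .
qed (simp only: funpow.simps id_apply of_nat_0 mult_zero_left \<rho>_0)

lemma \<rho>_is_linear: "z \<in> carrier (extraspecial sW f) \<Longrightarrow> Vector_Spaces.linear sV sV (\<rho> z)"
  using hom_in_carrier[OF hom] by (simp add: GL_def)

text \<open>The operator commutes with all others, and its order divides p because c generates a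
  group of exponent p.\<close>

lemma center_scalar:
  assumes irr: "abs_irreducible sV (extraspecial sW f) \<rho>"
  shows "\<exists>a. \<rho> ((0, 0), c) = sV a"
proof (rule schur_finite_order[OF vsV irr \<rho>_is_linear])
  have z: "((0, 0), c) \<in> carrier (extraspecial sW f)" unfolding carrier_extraspecial using dual_closed(1) by blast
  show "Vector_Spaces.linear sV sV (\<rho> ((0, 0), c))" by (rule \<rho>_is_linear[OF z])
  show "CARD('p) > 0" by simp
  show "\<rho> ((0, 0), c) ^^ CARD('p) = id" by (rule ext) (simp add: \<rho>_center_power \<rho>_0)
  show "\<rho> ((0, 0), c) \<circ> \<rho> z = \<rho> z \<circ> \<rho> ((0, 0), c)" if z: "z \<in> carrier (extraspecial sW f)" for z
  proof -
    obtain \<beta> x d where "\<beta> \<in> D" "z = ((\<beta>, x), d)" using z unfolding carrier_extraspecial by blast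
    then show ?thesis
      using \<rho>_mult[OF _ dual_closed(1), of \<beta> 0 c x d] \<rho>_mult[OF dual_closed(1), of \<beta> x d 0 c]
      by (auto simp: dualD add.commute)
  qed
qed ((rule exI)?, assumption)+

text \<open>
  If the center acted trivially, all operators would commute, and being of order dividing
  \<open>p\<close> they would be scalars.
\<close>

lemma center_nontrivial:
  assumes irr: "abs_irreducible sV (extraspecial sW f) \<rho>" and dim: "V.dim UNIV \<noteq> 1"
  shows "\<rho> ((0, 0), 1) \<noteq> id"
proof
  assume triv: "\<rho> ((0, 0), 1) = id"
  have c: "\<rho> ((0, 0), c) v = v" for c v
  proof -
    obtain i where "c = of_nat i" using surj_of_nat_mod_ring by blast
    then show ?thesis using \<rho>_center_power[of i 1 v] by (simp add: triv)
  qed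
  have indep: "\<rho> ((\<beta>, x), c) v = \<rho> ((\<beta>, x), 0) v" if "\<beta> \<in> D" for \<beta> x c v
    using \<rho>_mult[OF that dual_closed(1), of 0 c x 0 v] by (simp add: c)
  have mult: "\<rho> ((\<gamma>, y), b) (\<rho> ((\<beta>, x), a) v) = \<rho> ((\<beta> + \<gamma>, x + y), 0) v" if "\<beta> \<in> D" "\<gamma> \<in> D" for \<beta> \<gamma> x y a b v
    unfolding \<rho>_mult[OF that] by (rule indep[OF dual_closed(2)[OF that]])
  have "\<exists>a. \<rho> z = sV a" if z: "z \<in> carrier (extraspecial sW f)" for z
  proof (rule schur_finite_order[OF vsV irr \<rho>_is_linear \<rho>_is_linear[OF z]])
    obtain \<beta> x d where \<beta>: "\<beta> \<in> D" and zeq: "z = ((\<beta>, x), d)" using z unfolding carrier_extraspecial by blast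
    show "CARD('p) > 0" by simp
    have "(\<rho> z ^^ i) v = \<rho> ((\<lambda>w. of_nat i * \<beta> w, sW (of_nat i) x), 0) v" for i v
    proof (induction i)
      case (Suc i)
      have "(\<lambda>w. of_nat i * \<beta> w) + \<beta> = (\<lambda>w. of_nat (Suc i) * \<beta> w)" by (simp add: fun_eq_iff algebra_simps)
      then show ?case
        using Suc mult[OF dual_closed(5)[OF \<beta>] \<beta>, of x d "of_nat i" "sW (of_nat i) x" 0 v]
        by (simp add: zeq W.scale_left_distrib add.commute)
    qed (simp add: \<rho>_0 flip: zero_fun_def)
    \<comment> \<open>K has characteristic p, so the p-fold multiples of \<beta> and x are
      zero.\<close>
    from this[of "CARD('p)"] show "\<rho> z ^^ CARD('p) = id"
      by (simp add: fun_eq_iff \<rho>_0 flip: char zero_fun_def)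
    show "\<rho> z \<circ> \<rho> z' = \<rho> z' \<circ> \<rho> z" if "z' \<in> carrier (extraspecial sW f)" for z'
    proof -
      obtain \<gamma> y b where "\<gamma> \<in> D" "z' = ((\<gamma>, y), b)" using \<open>z' \<in> _\<close> unfolding carrier_extraspecial by blast
      then show ?thesis unfolding zeq using \<beta> by (auto simp: mult add.commute)
    qed
  qed ((rule exI)?, assumption)+
  from dim_scalar_representation[OF vsV irr this] dim show False by simp
qed

end

text \<open>\<open>\<chi>\<close> is the character through which the center acts, and
  \<open>\<chi> 1\<close> is the scalar called \<epsilon>.\<close>

locale heisenberg_representation = extraspecial_representation sW T f sV \<rho>
  for sW :: "'k::finite_field \<Rightarrow> 'w::ab_group_add \<Rightarrow> 'w" and T :: "'k \<Rightarrow> 'p::prime_card mod_ring"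
    and f :: "('k, 'w) dbl \<Rightarrow> ('k, 'w) dbl \<Rightarrow> 'p mod_ring"
    and sV :: "'l::field \<Rightarrow> 'v::ab_group_add \<Rightarrow> 'v"
    and \<rho> :: "('k, 'w) dbl \<times> 'p mod_ring \<Rightarrow> 'v \<Rightarrow> 'v" +
  fixes \<chi> :: "'p mod_ring \<Rightarrow> 'l"
  assumes center: "\<rho> ((0, 0), c) = sV (\<chi> c)" and nontrivial: "\<chi> 1 \<noteq> 1" and nonzero: "\<exists>v :: 'v. v \<noteq> 0"
begin

lemma sV_inj: "sV a = sV b \<Longrightarrow> a = b"
  using nonzero V.scale_right_imp_eq by metis

lemma \<chi>_add: "\<chi> (a + b) = \<chi> a * \<chi> b"
proof (rule sV_inj, rule ext)
  fix v
  show "sV (\<chi> (a + b)) v = sV (\<chi> a * \<chi> b) v"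
    using \<rho>_mult[OF dual_closed(1) dual_closed(1), of 0 b 0 a v] by (auto simp: center mult.commute)
qed

lemma \<chi>_0 [simp]: "\<chi> 0 = 1"
proof -
  have "\<chi> 0 \<noteq> 0" using \<rho>_linear(5)[OF dual_closed(1), of 0 0] nonzero
    by (auto simp: center bij_def inj_def)
  then show ?thesis using \<chi>_add[of 0 0] by simp
qed

text \<open>In characteristic p the freshman's dream turns \<open>\<chi> 1\<close> ^ p = 1 into
  (\<open>\<chi> 1\<close> - 1)^p = 0, against nontriviality.\<close>

lemma CARD_ne_0: "of_nat CARD('p) \<noteq> (0 :: 'l)"
proof
  assume 0: "of_nat CARD('p) = (0 :: 'l)"
  then have "CHAR('l) dvd CARD('p)" by (simp add: of_nat_eq_0_iff_char_dvd)
  moreover have "CHAR('l) \<noteq> 1" using of_nat_CHAR[where 'a='l] by auto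
  ultimately have CHAR: "CHAR('l) = CARD('p)" using prime_card[where 'a='p] by (metis prime_nat_iff)
  have "\<chi> (of_nat i) = \<chi> 1 ^ i" for i by (induction i) (simp_all add: \<chi>_add)
  from this[of "CARD('p)"] have "\<chi> 1 ^ CARD('p) = 1" by simp
  moreover have "(1 + (\<chi> 1 - 1)) ^ CARD('p) = 1 ^ CARD('p) + (\<chi> 1 - 1) ^ CARD('p)"
    using CHAR prime_card[where 'a='p] by (intro freshmans_dream) simp_all
  ultimately have "(\<chi> 1 - 1) ^ CARD('p) = 0" by simp
  then show False using nontrivial by simp
qed

section \<open>Character sums over W and its dual\<close>

lemma sum_dual_character:
  "(\<Sum>\<beta>\<in>D. \<chi> (T (\<beta> x))) = (if x = 0 then of_nat (card D) else 0)"
proof (cases "x = 0")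
  case True
  then show ?thesis by (simp add: dualD(3) cong: sum.cong)
next
  case False
  then obtain \<gamma> where \<gamma>: "\<gamma> \<in> D" "T (\<gamma> x) = 1" by (rule dual_separates)
  \<comment> \<open>Translation by \<gamma> multiplies every term by
    \<open>\<chi> 1\<close>.\<close>
  have "(\<Sum>\<beta>\<in>D. \<chi> (T (\<beta> x))) = 0"
  proof (rule sum_character_zero[OF _ _ nontrivial])
    show "bij_betw ((+) \<gamma>) D D"
      by (rule bij_betw_byWitness[of _ "\<lambda>\<beta>. \<beta> - \<gamma>"]) (auto simp: \<gamma> dual_closed)
  qed (simp add: T_add \<chi>_add \<gamma>)
  then show ?thesis using False by simp
qed

lemma sum_vector_character:
  assumes \<beta>: "\<beta> \<in> D"
  shows "(\<Sum>x\<in>UNIV. \<chi> (T (\<beta> x))) = (if \<beta> = 0 then of_nat CARD('w) else 0)"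
proof (cases "\<beta> = 0")
  case False
  then obtain y where y: "T (\<beta> y) = 1" using dual_nonzero[OF \<beta>] by blast
  have "(\<Sum>x\<in>UNIV. \<chi> (T (\<beta> x))) = 0"
  proof (rule sum_character_zero[OF _ _ nontrivial])
    show "bij_betw ((+) y) UNIV UNIV"
      by (rule bij_betw_byWitness[of _ "\<lambda>x. x - y"]) auto
  qed (simp add: dualD[OF \<beta>] T_add \<chi>_add y)
  then show ?thesis using False by simp
qed simp

lemma CARD_w_ne_0: "of_nat CARD('w) \<noteq> (0 :: 'l)"
proof -
  have "CARD('w) = CARD('k) ^ W.dim UNIV"
    using card_subspace[OF vsW finite_class.finite_UNIV finW W.subspace_UNIV] .
  moreover obtain m where "CARD('k) = CARD('p) ^ m" by (rule CARD_power_of_prime[OF char])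
  ultimately show ?thesis using CARD_ne_0 by simp
qed

text \<open>Evaluating the double sum of \<chi>(T(x \<beta>)) in both orders gives |D| = |W| in K',
  and |W| is a power of p.\<close>

lemma card_dual_ne_0: "of_nat (card D) \<noteq> (0 :: 'l)"
proof -
  have "of_nat (card D) = (\<Sum>x\<in>(UNIV :: 'w set). if x = 0 then of_nat (card D) else 0 :: 'l)"
    using finW by (simp add: sum.delta')
  also have "\<dots> = (\<Sum>x\<in>UNIV. \<Sum>\<beta>\<in>D. \<chi> (T (\<beta> x)))" by (simp add: sum_dual_character)
  also have "\<dots> = (\<Sum>\<beta>\<in>D. \<Sum>x\<in>UNIV. \<chi> (T (\<beta> x)))" by (rule sum.swap)
  also have "\<dots> = (\<Sum>\<beta>\<in>D. if \<beta> = 0 then of_nat CARD('w) else 0)"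
    by (intro sum.cong refl) (simp add: sum_vector_character)
  also have "\<dots> = of_nat CARD('w)" using finite_dual dual_closed(1) by (simp add: sum.delta')
  finally show ?thesis using CARD_w_ne_0 by simp
qed

section \<open>Translations, modulations and weight spaces\<close>

definition shift :: "'w \<Rightarrow> 'v \<Rightarrow> 'v" where "shift y = \<rho> ((0, y), 0)"
definition modul :: "('w \<Rightarrow> 'k) \<Rightarrow> 'v \<Rightarrow> 'v" where "modul \<beta> = \<rho> ((\<beta>, 0), 0)"

lemmas shift_linear = \<rho>_linear[OF dual_closed(1), of _ 0, folded shift_def]
lemmas modul_linear = \<rho>_linear[of _ 0 0, folded modul_def]

text \<open>The cocycle f vanishes on pairs from W, as it does on pairs from \<open>D\<close>, so
  \<open>shift\<close> and \<open>modul\<close> are genuine homomorphisms.\<close>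

lemma shift_shift: "shift y (shift z v) = shift (z + y) v"
  using \<rho>_mult[OF dual_closed(1) dual_closed(1), of y 0 z 0 v] by (simp add: shift_def)

lemma modul_modul: "\<beta> \<in> D \<Longrightarrow> \<gamma> \<in> D \<Longrightarrow> modul \<gamma> (modul \<beta> v) = modul (\<beta> + \<gamma>) v"
  using \<rho>_mult[of \<beta> \<gamma> 0 0 0 0 v] by (simp add: modul_def dualD)

lemma shift_0: "shift 0 v = v" and modul_0: "modul 0 v = v"
  using center[of 0] by (simp_all add: shift_def modul_def)

lemma \<rho>_eq_shift_modul: "\<beta> \<in> D \<Longrightarrow> \<rho> ((\<beta>, y), 0) v = shift y (modul \<beta> v)"
  using \<rho>_mult[OF _ dual_closed(1), of \<beta> y 0 0 0 v] by (simp add: shift_def modul_def)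

text \<open>The Weyl commutation relation: in E(f) the product of (0, y) and (\<beta>, 0) carries
  the cocycle T(\<beta> y), the product in the other order carries 0.\<close>

lemma modul_shift: "\<beta> \<in> D \<Longrightarrow> modul \<beta> (shift y v) = sV (\<chi> (T (\<beta> y))) (shift y (modul \<beta> v))"
  using \<rho>_mult[OF dual_closed(1), of \<beta> 0 0 y 0 v]
    \<rho>_mult[OF _ dual_closed(1), of \<beta> 0 "T (\<beta> y)" y 0 v]
    \<rho>_mult[OF _ dual_closed(1), of \<beta> y 0 0 0 v]
  by (simp add: shift_def modul_def center)

lemma inv_\<rho>:
  assumes "\<beta> \<in> D"
  shows "(inv\<^bsub>GL sV\<^esub> (\<rho> ((\<beta>, y), 0))) v = modul (- \<beta>) (shift (- y) v)"
proof -
  have neg: "- \<beta> \<in> D" using assms by (rule dual_closed(3))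
  have "shift (- y) \<in> carrier (GL sV)" "modul (- \<beta>) \<in> carrier (GL sV)"
    using \<rho>_closed[OF dual_closed(1)] \<rho>_closed[OF neg] by (simp_all add: shift_def modul_def)
  then have "shift (- y) \<otimes>\<^bsub>GL sV\<^esub> modul (- \<beta>) \<in> carrier (GL sV)"
    by (rule monoid.m_closed[OF monoid_GL[OF vsV]])
  then have *: "modul (- \<beta>) \<circ> shift (- y) \<in> carrier (GL sV)" by (simp add: GL_def)
  have "\<rho> ((\<beta>, y), 0) = shift y \<circ> modul \<beta>" using \<rho>_eq_shift_modul[OF assms] by auto
  then have "modul (- \<beta>) \<circ> shift (- y) = inv\<^bsub>GL sV\<^esub> (\<rho> ((\<beta>, y), 0))"
    using assms neg
    by (intro monoid.inv_unique'[OF monoid_GL[OF vsV] \<rho>_closed[OF assms] *])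
      (auto simp: GL_def fun_eq_iff modul_modul shift_shift shift_0 modul_0)
  from fun_cong[OF this, of v] show ?thesis by simp
qed

text \<open>Membership in the weight space \<open>E\<^sub>x\<close>, with the zero vector
  included.\<close>

definition eigen :: "'w \<Rightarrow> 'v \<Rightarrow> bool" where
  "eigen x v \<longleftrightarrow> (\<forall>\<beta>\<in>D. modul \<beta> v = sV (\<chi> (T (\<beta> x))) v)"

lemma eigen_shift:
  assumes "eigen x v"
  shows "eigen (x + y) (shift y v)"
  using assms by (simp add: eigen_def modul_shift dualD shift_linear T_add \<chi>_add mult.commute)

text \<open>The projection onto \<open>E\<^sub>x\<close> without its normalization: on
  \<open>E\<^sub>x\<close> it is multiplication by |D|.\<close>

definition proj :: "'w \<Rightarrow> 'v \<Rightarrow> 'v" where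
  "proj x v = (\<Sum>\<beta>\<in>D. sV (\<chi> (- T (\<beta> x))) (modul \<beta> v))"

lemma eigen_proj: "eigen x (proj x v)"
  unfolding eigen_def
proof
  fix \<gamma> assume \<gamma>: "\<gamma> \<in> D"
  have "modul \<gamma> (proj x v) = (\<Sum>\<beta>\<in>D. sV (\<chi> (- T (\<beta> x))) (modul (\<beta> + \<gamma>) v))"
    unfolding proj_def using \<gamma> by (simp add: modul_linear modul_modul cong: sum.cong)
  \<comment> \<open>Replacing \<beta> by \<beta> - \<gamma> moves \<gamma> from the operator into
    the character.\<close>
  also have "\<dots> = (\<Sum>\<beta>\<in>D. sV (\<chi> (- T ((\<beta> - \<gamma>) x))) (modul (\<beta> - \<gamma> + \<gamma>) v))"
    by (rule sum.reindex_bij_betw[symmetric], rule bij_betw_byWitness[of _ "\<lambda>\<beta>. \<beta> + \<gamma>"])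
      (auto simp: \<gamma> dual_closed dual_closed(4)[unfolded fun_diff_def])
  also have "\<dots> = sV (\<chi> (T (\<gamma> x))) (proj x v)"
    unfolding proj_def V.scale_sum_right
    by (intro sum.cong refl) (simp add: T_diff mult.commute flip: \<chi>_add)
  finally show "modul \<gamma> (proj x v) = sV (\<chi> (T (\<gamma> x))) (proj x v)" .
qed

text \<open>Fourier inversion: summing over x first kills every term except \<beta> = 0.\<close>

lemma sum_proj: "(\<Sum>x\<in>UNIV. proj x v) = sV (of_nat CARD('w)) v"
proof -
  have "(\<Sum>x\<in>UNIV. proj x v) = (\<Sum>\<beta>\<in>D. sV (\<Sum>x\<in>UNIV. \<chi> (T ((- \<beta>) x))) (modul \<beta> v))"
    unfolding proj_def by (subst sum.swap) (simp add: V.scale_sum_left T_minus)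
  also have "\<dots> = (\<Sum>\<beta>\<in>D. if \<beta> = 0 then sV (of_nat CARD('w)) v else 0)"
    by (intro sum.cong refl) (subst sum_vector_character, auto simp: dual_closed modul_0)
  also have "\<dots> = sV (of_nat CARD('w)) v" using finite_dual dual_closed(1) by (simp add: sum.delta')
  finally show ?thesis .
qed

text \<open>By \<open>sum_proj\<close>, and since |W| is invertible in K', every vector is a sum of
  weight vectors.\<close>

lemma eq_if_eq_on_eigen:
  assumes "\<And>v w. A (v + w) = A v + A w" "\<And>v w. B (v + w) = B v + B w"
    and "\<And>c v. A (sV c v) = sV c (A v)" "\<And>c v. B (sV c v) = sV c (B v)"
    and "\<And>x v. eigen x v \<Longrightarrow> A v = B v"
  shows "A v = B v"
proof -
  interpret A: Vector_Spaces.linear sV sV A using assms vsV by (simp add: Vector_Spaces.linear_iff)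
  interpret B: Vector_Spaces.linear sV sV B using assms vsV by (simp add: Vector_Spaces.linear_iff)
  have "v = sV (inverse (of_nat CARD('w))) (\<Sum>x\<in>UNIV. proj x v)"
    unfolding sum_proj using CARD_w_ne_0 by simp
  then have v: "v = (\<Sum>x\<in>UNIV. sV (inverse (of_nat CARD('w))) (proj x v))" unfolding V.scale_sum_right .
  have "A (\<Sum>x\<in>UNIV. sV (inverse (of_nat CARD('w))) (proj x v)) = B (\<Sum>x\<in>UNIV. sV (inverse (of_nat CARD('w))) (proj x v))"
    by (simp add: A.sum B.sum A.scale B.scale assms(5)[OF eigen_proj])
  with v show ?thesis by simp
qed

lemma eigenvector_exists: obtains x v where "eigen x v" "v \<noteq> 0"
proof -
  obtain u :: 'v where u: "u \<noteq> 0" using nonzero by blast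
  have "\<exists>x. proj x u \<noteq> 0"
  proof (rule ccontr)
    assume "\<not> ?thesis"
    then have "sV (of_nat CARD('w)) u = 0" using sum_proj[of u] by simp
    then show False using u CARD_w_ne_0 by simp
  qed
  then show ?thesis using that eigen_proj by blast
qed

section \<open>The operators s(g) on weight spaces and the factor set\<close>

lemma s_op_summand:
  assumes g: "g \<in> carrier G" and v: "eigen x v" and \<beta>: "\<beta> \<in> D"
    and u: "wpart g u = wpart g x - x - y + wpart g y"
  shows "(\<rho> ((\<beta>, y), 0) \<otimes>\<^bsub>GL sV\<^esub> inv\<^bsub>GL sV\<^esub> (\<rho> (g (\<beta>, y), 0))) v =
    sV (\<chi> (T (\<beta> u))) (shift (y - wpart g y) v)"
proof -
  note s = isometry_split[OF g]
  let ?a = "wpart g" and ?d = "dpart g \<beta>"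
  have d: "?d \<in> D" "- ?d \<in> D" using s(2)[OF \<beta>] dual_closed(3) by auto
  have "(\<rho> ((\<beta>, y), 0) \<otimes>\<^bsub>GL sV\<^esub> inv\<^bsub>GL sV\<^esub> (\<rho> (g (\<beta>, y), 0))) v
      = modul (- ?d) (shift (- ?a y) (shift y (modul \<beta> v)))"
    by (simp add: GL_mult s(1)[OF \<beta>] inv_\<rho>[OF d(1)] \<rho>_eq_shift_modul[OF \<beta>])
  also have "\<dots> = modul (- ?d) (shift (y - ?a y) (sV (\<chi> (T (\<beta> x))) v))"
    using v \<beta> by (simp add: shift_shift eigen_def)
  also have "\<dots> = sV (\<chi> (T (\<beta> x))) (modul (- ?d) (shift (y - ?a y) v))"
    by (simp add: shift_linear modul_linear[OF d(2)])
  also have "\<dots> = sV (\<chi> (T (\<beta> x)) * \<chi> (T ((- ?d) (x + (y - ?a y))))) (shift (y - ?a y) v)"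
    using eigen_shift[OF v, of "y - ?a y"] d(2) unfolding eigen_def by simp
  \<comment> \<open>The hypothesis on u reads a u = a x - (x + y - a y). The blocks
    \<open>?d\<close> and a preserve the pairing T, so the two exponents combine into T(\<beta>
    u).\<close>
  also have "\<chi> (T (\<beta> x)) * \<chi> (T ((- ?d) (x + (y - ?a y)))) = \<chi> (T (\<beta> u))"
  proof -
    have "T (\<beta> u) = T (?d (?a x)) - T (?d (x + (y - ?a y)))"
      using s(3)[OF \<beta>, of u] u by (simp add: T_diff[symmetric] dualD(5)[OF d(1), symmetric] algebra_simps)
    also have "\<dots> = T (\<beta> x) + T ((- ?d) (x + (y - ?a y)))" by (simp add: s(3)[OF \<beta>] T_minus)
    finally show ?thesis by (simp flip: \<chi>_add)
  qed
  finally show ?thesis .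
qed

text \<open>For fixed y the sum over \<beta> survives only if u = 0, that is y - a y = a x - x, and
  then every surviving y gives the same translation. There are |ker (1 - a)| such y, so the
  coefficient is |ker (1 - a)| |D| / |V|, which \<open>CARD_eq_fixed_j_dim\<close> turns into
  \<mu>(g).\<close>

lemma s_op_eigen:
  assumes g: "g \<in> carrier G" and v: "eigen x v"
  shows "s_op sW sV \<rho> g v = sV (inverse (of_nat CARD('k) ^ j_dim sW g)) (shift (wpart g x - x) v)"
proof -
  let ?a = "wpart g" and ?z = "wpart g x - x"
  note s = isometry_split[OF g]
  let ?t = "\<lambda>\<beta> y. (\<rho> ((\<beta>, y), 0) \<otimes>\<^bsub>GL sV\<^esub> inv\<^bsub>GL sV\<^esub> (\<rho> (g (\<beta>, y), 0))) v"
  define N where "N = card {y. y - ?a y = 0}"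
  have sum_y: "(\<Sum>\<beta>\<in>D. ?t \<beta> y) = (if y - ?a y = ?z then sV (of_nat (card D)) (shift ?z v) else 0)" for y
  proof -
    obtain u where u: "?a u = ?a x - x - y + ?a y" using s(6) by (metis bij_pointE)
    have "(\<Sum>\<beta>\<in>D. ?t \<beta> y) = sV (\<Sum>\<beta>\<in>D. \<chi> (T (\<beta> u))) (shift (y - ?a y) v)"
      unfolding V.scale_sum_left by (intro sum.cong refl) (rule s_op_summand[OF g v _ u])
    also have "\<dots> = sV (if u = 0 then of_nat (card D) else 0) (shift (y - ?a y) v)"
      by (simp only: sum_dual_character)
    also have "u = 0 \<longleftrightarrow> y - ?a y = ?z"
    proof -
      have "u = 0 \<longleftrightarrow> ?a u = ?a 0" using s(6) by (auto simp: bij_def inj_eq)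
      also have "\<dots> \<longleftrightarrow> y - ?a y = ?z" unfolding u wpart_0[OF g] by (auto simp: algebra_simps)
      finally show ?thesis .
    qed
    finally show ?thesis by auto
  qed
  have "s_op sW sV \<rho> g v = sV (inverse (of_nat (card (dbl_space sW)))) (\<Sum>y\<in>UNIV. \<Sum>\<beta>\<in>D. ?t \<beta> y)"
    unfolding s_op_def dbl_space_def sum.swap[of _ D] by (simp add: sum.cartesian_product case_prod_unfold)
  also have "(\<Sum>y\<in>UNIV. \<Sum>\<beta>\<in>D. ?t \<beta> y) = (\<Sum>y\<in>{y. y - ?a y = ?z}. sV (of_nat (card D)) (shift ?z v))"
    unfolding sum_y using finW by (simp add: sum.If_cases)
  also have "\<dots> = sV (of_nat (card {y. y - ?a y = ?z})) (sV (of_nat (card D)) (shift ?z v))"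
    by (simp add: V.sum_constant_scale)
  \<comment> \<open>One solution is y = -x, so the solutions form a coset of the kernel of 1 -
    a.\<close>
  also have "card {y. y - ?a y = ?z} = N"
    unfolding N_def
    by (rule card_eq_card_kernel_range(1)[OF finW, of _ "- x"])
      (use wpart_diff[OF g, of 0 x] wpart_0[OF g] in \<open>simp_all add: s(4)\<close>)
  finally have *: "s_op sW sV \<rho> g v = sV (inverse (of_nat (card (dbl_space sW))) * of_nat N * of_nat (card D)) (shift ?z v)"
    by (simp add: mult.assoc)
  have W: "of_nat CARD('w) = of_nat N * (of_nat CARD('k) ^ j_dim sW g :: 'l)"
    using CARD_eq_fixed_j_dim[OF g] by (simp add: N_def)
  then have ne: "of_nat N \<noteq> (0 :: 'l)" "(of_nat CARD('k) ^ j_dim sW g :: 'l) \<noteq> 0" using CARD_w_ne_0 by auto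
  have "card (dbl_space sW) = card D * CARD('w)" by (simp add: dbl_space_def card_cartesian_product)
  then have "inverse (of_nat (card (dbl_space sW))) * of_nat N * of_nat (card D)
      = inverse (of_nat CARD('k) ^ j_dim sW g :: 'l)"
    using ne card_dual_ne_0 by (simp add: W field_simps)
  with * show ?thesis by simp
qed

lemma s_op_linear:
  assumes g: "g \<in> carrier G"
  shows "s_op sW sV \<rho> g (v + w) = s_op sW sV \<rho> g v + s_op sW sV \<rho> g w"
    and "s_op sW sV \<rho> g (sV c v) = sV c (s_op sW sV \<rho> g v)"
proof -
  have lin: "Vector_Spaces.linear sV sV (\<rho> (y, 0) \<otimes>\<^bsub>GL sV\<^esub> inv\<^bsub>GL sV\<^esub> (\<rho> (g y, 0)))"
    if "y \<in> dbl_space sW" for y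
  proof -
    obtain \<beta> x where y: "y = (\<beta>, x)" "\<beta> \<in> D" using \<open>y \<in> dbl_space sW\<close> by (cases y) (auto simp: dbl_space_def)
    note d = isometry_split(2)[OF g y(2)]
    have "inv\<^bsub>GL sV\<^esub> (\<rho> (g y, 0)) = modul (- dpart g \<beta>) \<circ> shift (- wpart g x)"
      unfolding y isometry_split(1)[OF g y(2)] using inv_\<rho>[OF d] by auto
    then show ?thesis
      using vsV y d by (simp add: Vector_Spaces.linear_iff GL_def shift_linear modul_linear dual_closed \<rho>_linear)
  qed
  show "s_op sW sV \<rho> g (v + w) = s_op sW sV \<rho> g v + s_op sW sV \<rho> g w"
    "s_op sW sV \<rho> g (sV c v) = sV c (s_op sW sV \<rho> g v)"
    using lin unfolding s_op_def
    by (simp_all add: Vector_Spaces.linear_iff V.scale_right_distrib sum.distrib V.scale_sum_right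
        mult.commute cong: sum.cong)
qed

text \<open>On \<open>E\<^sub>x\<close>, s(g) translates to the weight a x and s(h) translates on
  from there; the total displacement is that of s(gh), while the scalars multiply. As weight vectors
  span, the resulting identity holds on all of V'.\<close>

lemma factor_set_eq:
  assumes g: "g \<in> carrier G" and h: "h \<in> carrier G"
  defines "\<mu> \<equiv> \<lambda>g. inverse (of_nat CARD('k) ^ j_dim sW g) :: 'l"
  shows "factor_set sW sV f \<rho> g h = \<mu> g * \<mu> h * inverse (\<mu> (g \<otimes>\<^bsub>G\<^esub> h))"
proof -
  let ?gh = "g \<otimes>\<^bsub>G\<^esub> h" and ?s = "s_op sW sV \<rho>"
  let ?c = "\<mu> g * \<mu> h * inverse (\<mu> ?gh)"
  have gh: "?gh \<in> carrier G"
    using isometry_group_mult_closed[OF vsW g h] by (simp add: isometry_group_mult)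
  have \<mu>: "\<mu> g \<noteq> 0" if g: "g \<in> carrier G" for g
  proof -
    have "of_nat CARD('w) = of_nat (card {x. x - wpart g x = 0}) * (of_nat CARD('k) ^ j_dim sW g :: 'l)"
      using CARD_eq_fixed_j_dim[OF g] by simp
    then show ?thesis using CARD_w_ne_0 by (auto simp: \<mu>_def)
  qed
  have mult: "?s g \<otimes>\<^bsub>GL sV\<^esub> ?s h = (\<lambda>v. ?s h (?s g v))" by (auto simp: GL_mult)
  have \<mu>_eq: "inverse (of_nat CARD('k) ^ j_dim sW g) = \<mu> g" for g by (simp add: \<mu>_def)
  have "?s h (?s g v) = sV ?c (?s ?gh v)" for v
  proof (rule eq_if_eq_on_eigen[of "\<lambda>v. ?s h (?s g v)" "\<lambda>v. sV ?c (?s ?gh v)"])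
    fix x v assume v: "eigen x v"
    have "eigen (wpart g x) (shift (wpart g x - x) v)" using eigen_shift[OF v, of "wpart g x - x"] by simp
    from s_op_eigen[OF h this] show "?s h (?s g v) = sV ?c (?s ?gh v)"
      using \<mu>[OF gh]
      by (simp add: s_op_eigen[OF g v] s_op_eigen[OF gh v] s_op_linear[OF h] shift_shift wpart_compose[OF g h] \<mu>_eq)
  qed (simp_all add: s_op_linear[OF g] s_op_linear[OF h] s_op_linear[OF gh] V.scale_right_distrib mult.commute)
  then have eq: "?s g \<otimes>\<^bsub>GL sV\<^esub> ?s h = (\<lambda>v. sV ?c (?s ?gh v))" unfolding mult by blast
  obtain x v where v: "eigen x v" "v \<noteq> 0" by (rule eigenvector_exists)
  \<comment> \<open>Translations are invertible, so s(gh) has a nonzero value, and the scalar in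
    \<open>factor_set\<close> is unique.\<close>
  have "shift (wpart ?gh x - x) v \<noteq> 0"
    using shift_shift[of "- (wpart ?gh x - x)" "wpart ?gh x - x" v] v(2) shift_0[of v] shift_linear(3) by (metis add.right_inverse)
  then have sv: "?s ?gh v \<noteq> 0" using \<mu>[OF gh] by (simp add: s_op_eigen[OF gh v(1)] \<mu>_eq)
  show ?thesis
    unfolding factor_set_def
  proof (rule the_equality)
    show "?c \<noteq> 0 \<and> ?s g \<otimes>\<^bsub>GL sV\<^esub> ?s h = (\<lambda>v. sV ?c (?s ?gh v))"
      using eq \<mu>[OF g] \<mu>[OF h] \<mu>[OF gh] by simp
    fix c assume "c \<noteq> 0 \<and> ?s g \<otimes>\<^bsub>GL sV\<^esub> ?s h = (\<lambda>v. sV c (?s ?gh v))"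
    then have "sV c (?s ?gh v) = sV ?c (?s ?gh v)" using eq by metis
    then show "c = ?c" using sv by (simp only: V.scale_cancel_right) simp
  qed
qed

end


text \<open>Automorphisms fix the prime subfield. If \<open>of_nat k\<close> is zero, both sides are
  zero by the convention that \<open>inverse 0\<close> is 0.\<close>

lemma field_automorphism_inverse_of_nat:
  assumes "field_automorphism \<eta>"
  shows "\<eta> (inverse (of_nat k)) = inverse (of_nat k)"
proof -
  note \<eta> = assms[unfolded field_automorphism_def]
  have "\<eta> 0 + \<eta> 0 = \<eta> (0 + 0)" using \<eta> by metis
  then have 0: "\<eta> 0 = 0" by (simp only: add_0_left add_cancel_left_right)
  have of_nat: "\<eta> (of_nat k) = of_nat k" by (induction k) (use \<eta> 0 in auto)
  show ?thesis
  proof (cases "of_nat k = (0 :: 'a)")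
    case False
    then have "\<eta> (of_nat k) * \<eta> (inverse (of_nat k)) = 1" using \<eta> by (metis right_inverse)
    then show ?thesis unfolding of_nat by (metis inverse_unique)
  qed (use 0 in simp)
qed

theorem theorem6p1:
  fixes sW :: "'k::finite_field \<Rightarrow> 'w::ab_group_add \<Rightarrow> 'w"
    and sV' :: "'l::field \<Rightarrow> 'v::ab_group_add \<Rightarrow> 'v"
    and f :: "('k, 'w) dbl \<Rightarrow> ('k, 'w) dbl \<Rightarrow> 'p::prime_card mod_ring"
    and \<rho> :: "('k, 'w) dbl \<times> 'p mod_ring \<Rightarrow> 'v \<Rightarrow> 'v"
    and \<sigma> :: "(('k, 'w) dbl \<Rightarrow> ('k, 'w) dbl) \<Rightarrow> (('k, 'w) dbl \<Rightarrow> ('k, 'w) dbl) \<Rightarrow> 'l"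
    and \<mu> :: "(('k, 'w) dbl \<Rightarrow> ('k, 'w) dbl) \<Rightarrow> 'l"
    and p q n :: nat
  assumes "CARD('p) = p" and "CHAR('k) = p" and "CARD('k) = q"
    and "vector_space sW" and "\<exists>x::'w. x \<noteq> 0"
    and "finite_dim (prime_scale sW :: 'p mod_ring \<Rightarrow> 'w \<Rightarrow> 'w)"
    and "vector_space.dim (prime_scale sW :: 'p mod_ring \<Rightarrow> 'w \<Rightarrow> 'w) UNIV = n"
    and "f = trace_form"
    and "vector_space sV'" and "vector_space.dim sV' UNIV = p ^ n"
    and "\<rho> \<in> hom (extraspecial sW f) (GL sV')"
    and "abs_irreducible sV' (extraspecial sW f) \<rho>"
    and "\<sigma> = factor_set sW sV' f \<rho>"
    and "\<mu> = (\<lambda>g. inverse (of_nat q ^ j_dim sW g))"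
  shows "(\<forall>g \<in> carrier (isometry_group sW f). \<forall>h \<in> carrier (isometry_group sW f).
            \<sigma> g h = \<mu> g * \<mu> h * inverse (\<mu> (g \<otimes>\<^bsub>isometry_group sW f\<^esub> h))) \<and>
         (\<forall>g \<in> carrier (isometry_group sW f). \<forall>\<eta>'. 
            field_automorphism \<eta>' \<and> \<eta>' (central_scalar sV' \<rho>) = inverse (central_scalar sV' \<rho>) \<longrightarrow>
            \<mu> g = \<eta>' (\<mu> (inv\<^bsub>isometry_group sW f\<^esub> g)))"
proof -
  have char: "CHAR('k) = CARD('p)" using assms(1,2) by simp
  interpret P: vector_space "prime_scale sW :: 'p mod_ring \<Rightarrow> 'w \<Rightarrow> 'w"
    by (rule vector_space_prime_scale[OF assms(4) char])
  obtain B :: "'w set" where B: "finite B" "P.independent B" "P.span B = UNIV"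
    using assms(6) by (auto simp: finite_dim_def is_basis_def)
  have finW: "finite (UNIV :: 'w set)"
    using finite_span_and_card(1)[OF P.vector_space_axioms finite_class.finite_UNIV B(1)] B(3) by simp
  \<comment> \<open>W is nonzero, so n > 0 and V' has dimension p^n > 1;
    \<open>center_nontrivial\<close> depends on this.\<close>
  have "B \<noteq> {}" using B(3) assms(5) by auto
  then have "n > 0" using P.dim_eq_card[of B UNIV] B assms(7) by (simp add: card_gt_0_iff)
  moreover have "p > 1" using assms(1) prime_gt_1_nat[OF prime_card[where 'a='p]] by simp
  ultimately have "p ^ n > 1" by (intro one_less_power)
  with assms(10) have dim: "vector_space.dim sV' UNIV > 1" by simp
  interpret R: extraspecial_representation sW "abs_trace :: 'k \<Rightarrow> 'p mod_ring" f sV' \<rho>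
    by (intro extraspecial_representation.intro finite_dual_pair.intro extraspecial_representation_axioms.intro)
      (rule assms char finW refl)+
  obtain \<chi> where \<chi>: "\<And>c. \<rho> ((0, 0), c) = sV' (\<chi> c)" using R.center_scalar[OF assms(12)] by metis
  have nontrivial: "\<chi> 1 \<noteq> 1"
  proof
    assume "\<chi> 1 = 1"
    then have "\<rho> ((0, 0), 1) = id" by (auto simp: \<chi>)
    with R.center_nontrivial[OF assms(12)] dim show False by simp
  qed
  have nonzero: "\<exists>v :: 'v. v \<noteq> 0"
  proof (rule ccontr)
    assume "\<not> ?thesis"
    then have "UNIV \<subseteq> R.V.span {}" by auto
    from R.V.dim_le_card[OF this] dim show False by simp
  qed
  interpret heisenberg_representation sW abs_trace f sV' \<rho> \<chi>
    by (intro heisenberg_representation.intro heisenberg_representation_axioms.intro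
        R.extraspecial_representation_axioms) (rule \<chi> nontrivial nonzero)+
  \<comment> \<open>I(g) is also the image attached to the inverse of g, so \<mu> agrees at both,
    and its value is the inverse of a natural number, fixed by every automorphism.\<close>
  have "\<mu> g = \<eta>' (\<mu> (inv\<^bsub>isometry_group sW f\<^esub> g))"
    if "g \<in> carrier (isometry_group sW f)" "field_automorphism \<eta>'" for g \<eta>'
    using field_automorphism_inverse_of_nat[OF that(2), of "q ^ j_dim sW g"]
    unfolding assms(14) j_dim_def I_img_inv[OF assms(4) that(1)] by simp
  then show ?thesis using factor_set_eq assms(3) unfolding assms(13,14) by simp
qed

end
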